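(* Let $X$ be a compact connected topological space and $f:X\to\mathbb{R}$ a continuous function. Then $(\mathrm{MT}(f),\pi_f)$ is a cellular merge tree (up to isomorphism of gauged spaces) if and only if $f$ has finitely many local minima. More precisely, for any labelled cellular merge tree $(T,\pi)$ with leaves $l_1,\ldots,l_n$, the gauged space $(\mathrm{MT}(f),\pi_f)$ is isomorphic to $(T,\pi)$ if and only if both of the following conditions are satisfied: 1. The function $f$ has finitely many local minima $X_1,\ldots,X_n$, with values $\pi(l_1),\ldots,\pi(l_n)$ respectively. 2. For any $1\leq i<j\leq n$, let $t_{ij}$ denote the infimum of the values $t$ for which $X_i$ and $X_j$ are in the same connected component of $f^{-1}(-\infty,t]$. Then $t_{ij}=\pi(\mathrm{LCA}(l_i,l_j))$.
   Context: Gauged spaces: a gauged space is a topological space $Z$ with a continuous map $\pi:Z\to\mathbb{R}$; an isomorphism $(Z_1,\pi_1)\to(Z_2,\pi_2)$ is a homeomorphism $\phi$ with $\pi_1=\pi_2\circ\phi$. Merge tree: for continuous $f:X\to\mathbb{R}$, $\mathrm{MT}(f)$ is the quotient of $\mathrm{epi}(f)=\{(x,t)\in X\times\mathbb{R}: t\geq f(x)\}$ by $(x,t)\sim(y,t)$ whenever $x$ and $y$ are in the same connected component of $f^{-1}(-\infty,t]$; $\pi_f:\mathrm{MT}(f)\to\mathbb{R}$ is induced by $(x,t)\mapsto t$. Local minimum: a nonempty connected subset $M\subseteq X$ on which $f$ is constant, such that any connected $M'$ strictly containing $M$ contains a point $x$ with $f(x)>f(M)$. Rooted trees: a tree is a finite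 connected acyclic graph; a geometric tree is the geometric realization of a tree. In a rooted tree $(T',r)$ edges are oriented away from $r$. A leaf is a vertex different from $r$ adjacent to exactly one other vertex (if $T'=\{r\}$, then $r$ counts as the unique leaf). A vertex $v'$ is a descendant of $v$ if there is a directed path from $v$ to $v'$ (possibly $v=v'$). $\mathrm{LCA}(v,v')$ is the least common ancestor. Cellular merge tree: $(T,\pi)$ where $T=T'\sqcup[0,1)/(r\sim 0)$ for a geometric rooted tree $(T',r)$, and $\pi:T\to\mathbb{R}$ is continuous, strictly decreasing along the edges of $T'$ oriented away from the root, and strictly increasing to infinity along $[0,1)$. It is labelled if an ordering $l_1,\ldots,l_n$ of its leaves (without repetition) and an ordering of its nodes are fixed.
   Formalization: "Compact" is taken to include Hausdorff (and "connected" to include nonempty); without Hausdorff the claim fails, e.g. for f=|x| on [-1,1] with doubled origin, whose merge tree is a half-line with doubled endpoint. *)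

theory Defs
  imports "HOL-Analysis.Analysis"
begin

section \<open>Quotients and disjoint unions of topological spaces\<close>

definition quotient_topology :: "'a topology \<Rightarrow> ('a \<times> 'a) set \<Rightarrow> 'a set topology" where
  "quotient_topology X R =
     topology (\<lambda>U. U \<subseteq> topspace X // R \<and> openin X {x \<in> topspace X. R `` {x} \<in> U})"

lemma openin_quotient_topology:
  "openin (quotient_topology X R) U \<longleftrightarrow>
     U \<subseteq> topspace X // R \<and> openin X {x \<in> topspace X. R `` {x} \<in> U}"
proof -
  let ?P = "\<lambda>U. U \<subseteq> topspace X // R \<and> openin X {x \<in> topspace X. R `` {x} \<in> U}"
  have "istopology ?P"
    unfolding istopology_def
  proof (intro conjI allI impI)
    fix S T assume "?P S" "?P T"
    moreover have "{x \<in> topspace X. R `` {x} \<in> S \<inter> T} =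
        {x \<in> topspace X. R `` {x} \<in> S} \<inter> {x \<in> topspace X. R `` {x} \<in> T}" by auto
    ultimately show "S \<inter> T \<subseteq> topspace X // R" "openin X {x \<in> topspace X. R `` {x} \<in> S \<inter> T}"
      by auto
  next
    fix K assume K: "\<forall>U\<in>K. ?P U"
    then show "\<Union> K \<subseteq> topspace X // R" by auto
    have "{x \<in> topspace X. R `` {x} \<in> \<Union> K} = (\<Union>U\<in>K. {x \<in> topspace X. R `` {x} \<in> U})"
      by auto
    then show "openin X {x \<in> topspace X. R `` {x} \<in> \<Union> K}" using K by auto
  qed
  then show ?thesis by (simp add: quotient_topology_def topology_inverse')
qed

lemma topspace_quotient_topology [simp]:
  "topspace (quotient_topology X R) = topspace X // R"
proof -
  have "{x \<in> topspace X. R `` {x} \<in> topspace X // R} = topspace X"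
    by (auto intro: quotientI)
  then have "openin (quotient_topology X R) (topspace X // R)"
    by (simp add: openin_quotient_topology)
  moreover have "topspace (quotient_topology X R) \<subseteq> topspace X // R"
    using openin_topspace[of "quotient_topology X R"]
    unfolding openin_quotient_topology by (rule conjunct1)
  ultimately show ?thesis by (intro subset_antisym openin_subset)
qed

lemma quotient_map_quotient_topology:
  "quotient_map X (quotient_topology X R) (\<lambda>x. R `` {x})"
proof -
  have "(\<lambda>x. R `` {x}) ` topspace X = topspace X // R" by (auto simp: quotient_def)
  then show ?thesis by (simp add: quotient_map_def openin_quotient_topology)
qed

definition disjoint_union_topology :: "'a topology \<Rightarrow> 'b topology \<Rightarrow> ('a + 'b) topology" where
  "disjoint_union_topology X Y =
     topology (\<lambda>U. openin X (Inl -` U) \<and> openin Y (Inr -` U))"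

lemma openin_disjoint_union_topology:
  "openin (disjoint_union_topology X Y) U \<longleftrightarrow> openin X (Inl -` U) \<and> openin Y (Inr -` U)"
proof -
  have "istopology (\<lambda>U. openin X (Inl -` U) \<and> openin Y (Inr -` U))"
    by (auto simp: istopology_def vimage_Union)
  then show ?thesis by (simp add: disjoint_union_topology_def topology_inverse')
qed

lemma topspace_disjoint_union_topology [simp]:
  "topspace (disjoint_union_topology X Y) = topspace X <+> topspace Y"
proof -
  have "Inl -` (topspace X <+> topspace Y) = topspace X"
    "Inr -` (topspace X <+> topspace Y) = topspace Y" by auto
  then have "openin (disjoint_union_topology X Y) (topspace X <+> topspace Y)"
    by (simp add: openin_disjoint_union_topology)
  moreover have "topspace (disjoint_union_topology X Y) \<subseteq> topspace X <+> topspace Y"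
    (is "?Z \<subseteq> _")
  proof
    fix z assume z: "z \<in> ?Z"
    have "Inl -` ?Z \<subseteq> topspace X" "Inr -` ?Z \<subseteq> topspace Y"
      using openin_topspace[of "disjoint_union_topology X Y"]
      unfolding openin_disjoint_union_topology by (simp_all add: openin_subset)
    with z show "z \<in> topspace X <+> topspace Y" by (cases z) auto
  qed
  ultimately show ?thesis by (intro subset_antisym openin_subset)
qed


section \<open>Gauged spaces\<close>

definition gauged_space :: "'a topology \<Rightarrow> ('a \<Rightarrow> real) \<Rightarrow> bool" where
  "gauged_space Z p \<longleftrightarrow> continuous_map Z euclideanreal p"

definition gauged_isomorphic ::
  "'a topology \<Rightarrow> ('a \<Rightarrow> real) \<Rightarrow> 'b topology \<Rightarrow> ('b \<Rightarrow> real) \<Rightarrow> bool" where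
  "gauged_isomorphic Z1 p1 Z2 p2 \<longleftrightarrow>
     (\<exists>\<phi>. homeomorphic_map Z1 Z2 \<phi> \<and> (\<forall>z\<in>topspace Z1. p1 z = p2 (\<phi> z)))"


section \<open>Merge trees\<close>

text \<open>Pitfall: compactness of the space underlying a merge tree has to include the Hausdorff
  property. On the interval \<open>[-1, 1]\<close> with doubled origin (quasi-compact and connected) the
  function \<open>\<bar>x\<bar>\<close> has exactly two local minima, both origins, but its merge tree is a half-line
  with doubled endpoint, which is not Hausdorff.\<close>

definition sublevel :: "'a topology \<Rightarrow> ('a \<Rightarrow> real) \<Rightarrow> real \<Rightarrow> 'a set" where
  "sublevel X f t = {x \<in> topspace X. f x \<le> t}"

definition epigraph_of :: "'a topology \<Rightarrow> ('a \<Rightarrow> real) \<Rightarrow> ('a \<times> real) set" where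
  "epigraph_of X f = {(x, t). x \<in> topspace X \<and> f x \<le> t}"

text \<open>Membership of both points in the epigraph is automatic, since
  \<^const>\<open>connected_component_of\<close> forces both arguments into the sublevel set.\<close>

definition merge_rel :: "'a topology \<Rightarrow> ('a \<Rightarrow> real) \<Rightarrow> (('a \<times> real) \<times> ('a \<times> real)) set" where
  "merge_rel X f =
     {((x, t), (y, t)) | x y t. connected_component_of (subtopology X (sublevel X f t)) x y}"

definition merge_tree :: "'a topology \<Rightarrow> ('a \<Rightarrow> real) \<Rightarrow> ('a \<times> real) set topology" where
  "merge_tree X f =
     quotient_topology (subtopology (prod_topology X euclideanreal) (epigraph_of X f))
       (merge_rel X f)"

text \<open>All points of a class have the same second coordinate, which is the value of the gauge.\<close>

definition merge_tree_gauge :: "('a \<times> real) set \<Rightarrow> real" where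
  "merge_tree_gauge c = the_elem (snd ` c)"

lemma topspace_epigraph [simp]:
  "topspace (subtopology (prod_topology X euclideanreal) (epigraph_of X f)) = epigraph_of X f"
  by (auto simp: epigraph_of_def)

lemma equiv_merge_rel: "equiv (epigraph_of X f) (merge_rel X f)"
proof (rule equivI)
  show "merge_rel X f \<subseteq> epigraph_of X f \<times> epigraph_of X f"
    by (auto simp: merge_rel_def epigraph_of_def sublevel_def
        dest: connected_component_in_topspace)
  show "refl_on (epigraph_of X f) (merge_rel X f)"
    by (auto simp: refl_on_def merge_rel_def epigraph_of_def sublevel_def
        connected_component_of_refl)
  show "sym (merge_rel X f)"
    by (auto simp: sym_def merge_rel_def connected_component_of_sym)
  show "trans (merge_rel X f)"
    unfolding trans_def merge_rel_def by (blast intro: connected_component_of_trans)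
qed

lemma merge_tree_gauge_class:
  assumes "(x, t) \<in> epigraph_of X f"
  shows "merge_tree_gauge (merge_rel X f `` {(x, t)}) = t"
proof -
  have "((x, t), (x, t)) \<in> merge_rel X f"
    using equiv_merge_rel[of X f] assms by (meson equivE refl_onD)
  moreover have "snd q = t" if "((x, t), q) \<in> merge_rel X f" for q
    using that by (auto simp: merge_rel_def)
  ultimately have "snd ` (merge_rel X f `` {(x, t)}) = {t}" by force
  then show ?thesis by (simp add: merge_tree_gauge_def)
qed

lemma gauged_space_merge_tree: "gauged_space (merge_tree X f) merge_tree_gauge"
proof -
  let ?E = "subtopology (prod_topology X euclideanreal) (epigraph_of X f)"
  have "continuous_map ?E euclideanreal snd"
    by (intro continuous_map_from_subtopology continuous_map_snd)
  then have "continuous_map ?E euclideanreal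
      (merge_tree_gauge \<circ> (\<lambda>p. merge_rel X f `` {p}))"
    by (rule continuous_map_eq) (auto simp: merge_tree_gauge_class)
  then show ?thesis
    unfolding gauged_space_def merge_tree_def
    using continuous_compose_quotient_map_eq[OF quotient_map_quotient_topology] by metis
qed


section \<open>Local minima\<close>

definition common_value :: "('a \<Rightarrow> real) \<Rightarrow> 'a set \<Rightarrow> real" where
  "common_value f M = the_elem (f ` M)"

definition local_minima :: "'a topology \<Rightarrow> ('a \<Rightarrow> real) \<Rightarrow> 'a set set" where
  "local_minima X f =
     {M. M \<noteq> {} \<and> connectedin X M \<and> f constant_on M \<and>
         (\<forall>M'. connectedin X M' \<and> M \<subset> M' \<longrightarrow> (\<exists>x\<in>M'. f x > common_value f M))}"

definition merge_level :: "'a topology \<Rightarrow> ('a \<Rightarrow> real) \<Rightarrow> 'a set \<Rightarrow> 'a set \<Rightarrow> real" where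
  "merge_level X f A B =
     Inf {t. \<exists>C\<in>connected_components_of (subtopology X (sublevel X f t)). A \<subseteq> C \<and> B \<subseteq> C}"


section \<open>Rooted trees\<close>

text \<open>A graph is given by its vertex set and its set of two-element edges.\<close>

definition finite_graph :: "'v set \<Rightarrow> 'v set set \<Rightarrow> bool" where
  "finite_graph V E \<longleftrightarrow>
     finite V \<and> (\<forall>e\<in>E. \<exists>u v. e = {u, v} \<and> u \<in> V \<and> v \<in> V \<and> u \<noteq> v)"

definition graph_walk :: "'v set \<Rightarrow> 'v set set \<Rightarrow> 'v list \<Rightarrow> bool" where
  "graph_walk V E p \<longleftrightarrow> p \<noteq> [] \<and> set p \<subseteq> V \<and> successively (\<lambda>u v. {u, v} \<in> E) p"

definition graph_connected :: "'v set \<Rightarrow> 'v set set \<Rightarrow> bool" where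
  "graph_connected V E \<longleftrightarrow>
     V \<noteq> {} \<and> (\<forall>u\<in>V. \<forall>v\<in>V. \<exists>p. graph_walk V E p \<and> hd p = u \<and> last p = v)"

definition graph_cycle :: "'v set \<Rightarrow> 'v set set \<Rightarrow> 'v list \<Rightarrow> bool" where
  "graph_cycle V E c \<longleftrightarrow>
     graph_walk V E c \<and> distinct c \<and> 3 \<le> length c \<and> {last c, hd c} \<in> E"

definition graph_tree :: "'v set \<Rightarrow> 'v set set \<Rightarrow> bool" where
  "graph_tree V E \<longleftrightarrow>
     finite_graph V E \<and> graph_connected V E \<and> (\<nexists>c. graph_cycle V E c)"

definition rooted_tree :: "'v set \<Rightarrow> 'v set set \<Rightarrow> 'v \<Rightarrow> bool" where
  "rooted_tree V E r \<longleftrightarrow> graph_tree V E \<and> r \<in> V"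

text \<open>The edges oriented away from the root: \<open>(u, v)\<close> is such an arc if a simple path
  from the root traverses the edge from \<open>u\<close> to \<open>v\<close>.\<close>

definition tree_arcs :: "'v set \<Rightarrow> 'v set set \<Rightarrow> 'v \<Rightarrow> ('v \<times> 'v) set" where
  "tree_arcs V E r =
     {(u, v). \<exists>q. graph_walk V E (q @ [u, v]) \<and> distinct (q @ [u, v]) \<and> hd (q @ [u, v]) = r}"

definition tree_leaves :: "'v set \<Rightarrow> 'v set set \<Rightarrow> 'v \<Rightarrow> 'v set" where
  "tree_leaves V E r =
     (if V = {r} then {r} else {v \<in> V. v \<noteq> r \<and> (\<exists>!u. {u, v} \<in> E)})"

definition tree_nodes :: "'v set \<Rightarrow> 'v set set \<Rightarrow> 'v \<Rightarrow> 'v set" where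
  "tree_nodes V E r = V - tree_leaves V E r"

text \<open>\<open>descendant V E r v v'\<close> reads: \<open>v'\<close> is a descendant of \<open>v\<close>.\<close>

definition descendant :: "'v set \<Rightarrow> 'v set set \<Rightarrow> 'v \<Rightarrow> 'v \<Rightarrow> 'v \<Rightarrow> bool" where
  "descendant V E r v v' \<longleftrightarrow> v \<in> V \<and> v' \<in> V \<and> (v, v') \<in> (tree_arcs V E r)\<^sup>*"

definition LCA :: "'v set \<Rightarrow> 'v set set \<Rightarrow> 'v \<Rightarrow> 'v \<Rightarrow> 'v \<Rightarrow> 'v" where
  "LCA V E r v v' =
     (THE a. descendant V E r a v \<and> descendant V E r a v' \<and>
        (\<forall>b. descendant V E r b v \<and> descendant V E r b v' \<longrightarrow> descendant V E r b a))"


section \<open>Cellular merge trees\<close>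

text \<open>The geometric realization uses barycentric coordinates: a point is a function on the
  vertices with nonnegative values of sum one whose support is a vertex or an edge.  As there
  are finitely many vertices, the topology is the one inherited from the product.\<close>

definition geometric_realization :: "'v set \<Rightarrow> 'v set set \<Rightarrow> ('v \<Rightarrow> real) topology" where
  "geometric_realization V E =
     subtopology (powertop_real V)
       {a. (\<forall>v\<in>V. 0 \<le> a v) \<and> sum a V = 1 \<and>
           {v \<in> V. a v \<noteq> 0} \<in> (\<lambda>v. {v}) ` V \<union> E}"

definition edge_point :: "'v set \<Rightarrow> 'v \<Rightarrow> 'v \<Rightarrow> real \<Rightarrow> 'v \<Rightarrow> real" where
  "edge_point V u v s =
     (\<lambda>w\<in>V. (1 - s) * (if w = u then 1 else 0) + s * (if w = v then 1 else 0))"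

definition vertex_point :: "'v set \<Rightarrow> 'v \<Rightarrow> 'v \<Rightarrow> real" where
  "vertex_point V v = (\<lambda>w\<in>V. if w = v then 1 else 0)"

definition pre_cellular :: "'v set \<Rightarrow> 'v set set \<Rightarrow> (('v \<Rightarrow> real) + real) topology" where
  "pre_cellular V E =
     disjoint_union_topology (geometric_realization V E) (top_of_set {0..<1})"

definition glue_rel ::
  "'v set \<Rightarrow> 'v set set \<Rightarrow> 'v \<Rightarrow> ((('v \<Rightarrow> real) + real) \<times> (('v \<Rightarrow> real) + real)) set" where
  "glue_rel V E r =
     Id_on (topspace (pre_cellular V E)) \<union>
     {(Inl (vertex_point V r), Inr 0), (Inr 0, Inl (vertex_point V r))}"

definition cellular_space ::
  "'v set \<Rightarrow> 'v set set \<Rightarrow> 'v \<Rightarrow> (('v \<Rightarrow> real) + real) set topology" where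
  "cellular_space V E r = quotient_topology (pre_cellular V E) (glue_rel V E r)"

definition tree_pt ::
  "'v set \<Rightarrow> 'v set set \<Rightarrow> 'v \<Rightarrow> ('v \<Rightarrow> real) \<Rightarrow> (('v \<Rightarrow> real) + real) set" where
  "tree_pt V E r a = glue_rel V E r `` {Inl a}"

definition ray_pt ::
  "'v set \<Rightarrow> 'v set set \<Rightarrow> 'v \<Rightarrow> real \<Rightarrow> (('v \<Rightarrow> real) + real) set" where
  "ray_pt V E r s = glue_rel V E r `` {Inr s}"

definition vertex_pt ::
  "'v set \<Rightarrow> 'v set set \<Rightarrow> 'v \<Rightarrow> 'v \<Rightarrow> (('v \<Rightarrow> real) + real) set" where
  "vertex_pt V E r v = tree_pt V E r (vertex_point V v)"

definition cellular_merge_tree ::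
  "'v set \<Rightarrow> 'v set set \<Rightarrow> 'v \<Rightarrow> ((('v \<Rightarrow> real) + real) set \<Rightarrow> real) \<Rightarrow> bool" where
  "cellular_merge_tree V E r p \<longleftrightarrow>
     rooted_tree V E r \<and>
     gauged_space (cellular_space V E r) p \<and>
     (\<forall>(u, v)\<in>tree_arcs V E r.
        strict_antimono_on {0..1} (\<lambda>s. p (tree_pt V E r (edge_point V u v s)))) \<and>
     strict_mono_on {0..<1} (\<lambda>s. p (ray_pt V E r s)) \<and>
     filterlim (\<lambda>s. p (ray_pt V E r s)) at_top (at_left 1)"

text \<open>The orderings \<open>l\<close> of the leaves and \<open>d\<close> of the nodes are enumerations without
  repetition by \<open>{1..n}\<close> and \<open>{1..m}\<close>.\<close>

definition labelled_cellular_merge_tree ::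
  "'v set \<Rightarrow> 'v set set \<Rightarrow> 'v \<Rightarrow> ((('v \<Rightarrow> real) + real) set \<Rightarrow> real) \<Rightarrow>
   nat \<Rightarrow> (nat \<Rightarrow> 'v) \<Rightarrow> nat \<Rightarrow> (nat \<Rightarrow> 'v) \<Rightarrow> bool" where
  "labelled_cellular_merge_tree V E r p n l m d \<longleftrightarrow>
     cellular_merge_tree V E r p \<and>
     bij_betw l {1..n} (tree_leaves V E r) \<and>
     bij_betw d {1..m} (tree_nodes V E r)"

lemma topspace_pre_cellular:
  "topspace (pre_cellular V E) = topspace (geometric_realization V E) <+> {0..<1}"
  by (simp add: pre_cellular_def)

lemma vertex_point_in_realization:
  assumes "finite V" "v \<in> V"
  shows "vertex_point V v \<in> topspace (geometric_realization V E)"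
proof -
  have "{w \<in> V. vertex_point V v w \<noteq> 0} = {v}"
    using assms by (auto simp: vertex_point_def)
  then show ?thesis
    using assms by (simp add: geometric_realization_def) (simp add: vertex_point_def)
qed

lemma equiv_glue_rel:
  assumes "rooted_tree V E r"
  shows "equiv (topspace (pre_cellular V E)) (glue_rel V E r)"
proof -
  have "Inl (vertex_point V r) \<in> topspace (pre_cellular V E)"
    "Inr 0 \<in> topspace (pre_cellular V E)"
    using assms vertex_point_in_realization
    by (auto simp: topspace_pre_cellular rooted_tree_def graph_tree_def finite_graph_def)
  then show ?thesis
    by (intro equivI) (auto simp: glue_rel_def refl_on_def sym_def trans_def)
qed

end

theory Submission
  imports Defs "HOL-Real_Asymp.Real_Asymp"
begin

text \<open>
  Both sides of the characterization are gauged spaces made of finitely many branches: continuous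
  sections of the gauge on half-lines \<open>{c i..}\<close> that cover the space, have closed images and do
  not separate again once they have met (\<open>branch_system\<close>).  Such a gauged space is determined up
  to isomorphism by the heights at which branches start and the heights at which pairs of branches
  agree (\<open>branch_system_isomorphic\<close>), because a set is closed as soon as its trace on every
  branch is closed.

  In a cellular merge tree there is one branch for every leaf, and the branches of two leaves agree
  from the height of their lowest common ancestor on (\<open>leaf_branch_system\<close>).

  In a merge tree every point \<open>x\<close> gives the section sending \<open>t\<close> to the class of \<open>(x, t)\<close>.  Its
  image is closed because being in the same component of the sublevel set at level \<open>t\<close> as \<open>x\<close> is
  a closed condition on point and level (\<open>closedin_joined\<close>); here compactness and the Hausdorff
  property enter, through the equality of components and quasi-components.  Every component of a
  sublevel set contains a local minimum, so if there are finitely many local minima then the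
  branches above them form a branch system (\<open>merge_tree_branch_system\<close>), and two of these agree
  exactly from the merge level on.  This gives one direction of the characterization.

  For the other direction, a continuous section of the gauge of a branch system that starts on a
  branch stays on it, by connectedness of intervals (\<open>section_follows_branch\<close>).  Hence if the merge
  tree is isomorphic to a cellular merge tree, the branches transported from the latter are the
  upward sections of the former.  Leaves correspond to points with nothing below them, and these are
  the classes of the local minima at their own values (\<open>local_minima_of_branch_system\<close>).

  Finally, if \<open>f\<close> has finitely many local minima, the merge tree is cut at the finitely many
  heights where branches start or meet.  The points at these heights are the vertices of a rooted
  tree (\<open>branch_tree\<close>) whose leaves and lowest common ancestors have the heights required by the
  characterization, so the merge tree is isomorphic to this cellular merge tree.
\<close>

section \<open>Rooted trees\<close>

text \<open>Walks are handled through reachability in the edge relation restricted to a vertex set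
  \<open>S\<close>; reachability inside \<open>S\<close> yields a simple path inside \<open>S\<close>.\<close>

lemma distinct_walk_of_rtrancl:
  assumes "(x, y) \<in> {(u, v). {u, v} \<in> E \<and> u \<in> S \<and> v \<in> S}\<^sup>*" and "y \<in> S"
  shows "\<exists>q. graph_walk S E q \<and> distinct q \<and> hd q = x \<and> last q = y"
  using assms(1)
proof (induction rule: converse_rtrancl_induct)
  case base
  then show ?case using assms(2) by (intro exI[of _ "[y]"]) (simp add: graph_walk_def)
next
  case (step x z)
  then obtain q where q: "graph_walk S E q" "distinct q" "hd q = z" "last q = y" by auto
  show ?case
  proof (cases "x \<in> set q")
    case True
    then obtain as bs where "q = as @ x # bs" by (meson split_list)
    then show ?thesis using q
      by (intro exI[of _ "x # bs"]) (auto simp: graph_walk_def successively_append_iff)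
  next
    case False
    then show ?thesis using q step
      by (intro exI[of _ "x # q"]) (auto simp: graph_walk_def successively_Cons)
  qed
qed

lemma rtrancl_of_walk:
  assumes "graph_walk S E q"
  shows "(hd q, last q) \<in> {(u, v). {u, v} \<in> E \<and> u \<in> S \<and> v \<in> S}\<^sup>*"
  using assms
proof (induction q rule: induct_list012)
  case (3 x y zs)
  then have "(hd (y # zs), last (y # zs)) \<in> {(u, v). {u, v} \<in> E \<and> u \<in> S \<and> v \<in> S}\<^sup>*"
    by (auto simp: graph_walk_def)
  moreover have "(x, y) \<in> {(u, v). {u, v} \<in> E \<and> u \<in> S \<and> v \<in> S}"
    using 3 by (auto simp: graph_walk_def)
  ultimately have "(x, last (y # zs)) \<in> {(u, v). {u, v} \<in> E \<and> u \<in> S \<and> v \<in> S}\<^sup>*"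
    by (auto intro: converse_rtrancl_into_rtrancl simp only: list.sel)
  then show ?case by simp
qed (auto simp: graph_walk_def)

lemma sym_edge_rel: "sym ({(u, v). {u, v} \<in> E \<and> u \<in> S \<and> v \<in> S}\<^sup>*)"
  by (intro sym_rtrancl) (auto simp: sym_def insert_commute)

lemma acyclic_simple_path_unique:
  assumes "\<nexists>c. graph_cycle V E c"
    and "graph_walk V E p" "distinct p" "graph_walk V E q" "distinct q"
    and "hd p = hd q" "last p = last q"
  shows "p = q"
  using assms(2-)
proof (induction p arbitrary: q)
  case Nil
  then show ?case by (simp add: graph_walk_def)
next
  case (Cons a p)
  from Cons.prems obtain q' where q: "q = a # q'" by (cases q) (auto simp: graph_walk_def)
  show ?case
  proof (cases "p = [] \<or> q' = []")
    case True
    then show ?thesis using Cons.prems q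
      by (auto split: if_splits simp: graph_walk_def dest: last_in_set)
  next
    case False
    then obtain x p1 y q1 where px: "p = x # p1" and qy: "q' = y # q1"
      by (meson neq_Nil_conv)
    have wp: "graph_walk V E p" and wq: "graph_walk V E q'"
      using Cons.prems q px qy by (auto simp: graph_walk_def)
    show ?thesis
    proof (cases "x = y")
      case True
      then show ?thesis using Cons.IH[of q'] Cons.prems q px qy wp wq by auto
    next
      case False
      let ?R = "{(u, v). {u, v} \<in> E \<and> u \<in> V - {a} \<and> v \<in> V - {a}}"
      have "graph_walk (V - {a}) E p" "graph_walk (V - {a}) E q'"
        using wp wq Cons.prems q by (auto simp: graph_walk_def)
      then have "(x, last p) \<in> ?R\<^sup>*" "(y, last p) \<in> ?R\<^sup>*"
        using rtrancl_of_walk[of "V - {a}" E p] rtrancl_of_walk[of "V - {a}" E q']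
          px qy q Cons.prems by auto
      then have "(x, y) \<in> ?R\<^sup>*"
        using sym_edge_rel[of E "V - {a}"] by (meson rtrancl_trans symD)
      moreover have "y \<in> V - {a}"
        using Cons.prems q qy by (auto simp: graph_walk_def)
      ultimately obtain s where s: "graph_walk (V - {a}) E s" "distinct s" "hd s = x" "last s = y"
        using distinct_walk_of_rtrancl[of x y E "V - {a}"] by blast
      \<comment> \<open>\<open>x\<close> and \<open>y\<close> are distinct neighbours of \<open>a\<close>, joined by a path that avoids \<open>a\<close>.\<close>
      obtain s' where s': "s = x # s'" "s' \<noteq> []" using s False
        by (cases s) (auto simp: graph_walk_def split: if_splits)
      have "{a, x} \<in> E" "{y, a} \<in> E" "a \<in> V"
        using Cons.prems px qy q by (simp_all add: graph_walk_def insert_commute)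
      moreover have "3 \<le> length (a # s)"
        using s' by (cases s') auto
      ultimately have "graph_cycle V E (a # s)"
        using s s' by (auto simp: graph_cycle_def graph_walk_def)
      then show ?thesis using assms(1) by blast
    qed
  qed
qed

lemma rooted_tree_facts:
  assumes "rooted_tree V E r"
  shows "finite V" "r \<in> V" "\<nexists>c. graph_cycle V E c"
    "\<And>e. e \<in> E \<Longrightarrow> \<exists>u v. e = {u, v} \<and> u \<in> V \<and> v \<in> V \<and> u \<noteq> v"
  using assms by (auto simp: rooted_tree_def graph_tree_def finite_graph_def)

lemma rooted_tree_simple_path:
  assumes "rooted_tree V E r" and "v \<in> V"
  obtains q where "graph_walk V E q" "distinct q" "hd q = r" "last q = v"
proof -
  obtain p where "graph_walk V E p" "hd p = r" "last p = v"
    using assms unfolding rooted_tree_def graph_tree_def graph_connected_def by metis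
  then show ?thesis
    using rtrancl_of_walk[of V E p] distinct_walk_of_rtrancl[of r v E V] assms(2) that by auto
qed

lemma tree_arcs_edge:
  assumes "(u, v) \<in> tree_arcs V E r"
  shows "{u, v} \<in> E" "u \<in> V" "v \<in> V" "v \<noteq> r" "u \<noteq> v"
proof -
  obtain q where "graph_walk V E (q @ [u, v])" "distinct (q @ [u, v])" "hd (q @ [u, v]) = r"
    using assms by (auto simp: tree_arcs_def)
  then have "{u, v} \<in> E \<and> u \<in> V \<and> v \<in> V \<and> v \<noteq> r \<and> u \<noteq> v"
    by (auto simp: graph_walk_def successively_append_iff hd_append split: if_splits)
  then show "{u, v} \<in> E" "u \<in> V" "v \<in> V" "v \<noteq> r" "u \<noteq> v" by auto
qed

lemma tree_arcs_unique:
  assumes "rooted_tree V E r" and "(u, v) \<in> tree_arcs V E r" and "(u', v) \<in> tree_arcs V E r"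
  shows "u = u'"
proof -
  obtain q where "graph_walk V E (q @ [u, v])" "distinct (q @ [u, v])" "hd (q @ [u, v]) = r"
    using assms by (auto simp: tree_arcs_def)
  moreover obtain q' where "graph_walk V E (q' @ [u', v])" "distinct (q' @ [u', v])"
    "hd (q' @ [u', v]) = r"
    using assms by (auto simp: tree_arcs_def)
  ultimately have "q @ [u, v] = q' @ [u', v]"
    using acyclic_simple_path_unique[OF rooted_tree_facts(3)[OF assms(1)]] by simp
  then show ?thesis by simp
qed

lemma tree_arcs_path:
  assumes "graph_walk V E q" "distinct q" "hd q = r"
  shows "(r, last q) \<in> (tree_arcs V E r)\<^sup>*"
  using assms
proof (induction q rule: rev_induct)
  case (snoc v q)
  show ?case
  proof (cases "q = []")
    case False
    then obtain q' u where q: "q = q' @ [u]" by (meson rev_exhaust)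
    have "(r, u) \<in> (tree_arcs V E r)\<^sup>*"
      using snoc q by (auto simp: graph_walk_def successively_append_iff hd_append split: if_splits)
    moreover have "(u, v) \<in> tree_arcs V E r"
      using snoc.prems q by (auto simp: tree_arcs_def)
    ultimately show ?thesis by simp
  qed (use snoc in auto)
qed (simp add: graph_walk_def)

lemma root_ancestor:
  assumes "rooted_tree V E r" "v \<in> V"
  shows "(r, v) \<in> (tree_arcs V E r)\<^sup>*"
  using rooted_tree_simple_path[OF assms] tree_arcs_path by metis

lemma tree_arcs_parent_ex:
  assumes "rooted_tree V E r" "v \<in> V" "v \<noteq> r"
  shows "\<exists>u. (u, v) \<in> tree_arcs V E r"
  using root_ancestor[OF assms(1,2)] assms(3) by (metis rtranclE)

lemma edge_is_arc:
  assumes "rooted_tree V E r" "{u, v} \<in> E"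
  shows "(u, v) \<in> tree_arcs V E r \<or> (v, u) \<in> tree_arcs V E r"
proof -
  have uv: "u \<in> V" "v \<in> V" "u \<noteq> v"
    using rooted_tree_facts(4)[OF assms] by (auto simp: doubleton_eq_iff)
  obtain q where q: "graph_walk V E q" "distinct q" "hd q = r" "last q = u"
    using rooted_tree_simple_path[OF assms(1) uv(1)] .
  have qn: "q \<noteq> []" using q by (auto simp: graph_walk_def)
  show ?thesis
  proof (cases "v \<in> set q")
    case False
    then have "graph_walk V E (butlast q @ [u, v]) \<and> distinct (butlast q @ [u, v])
      \<and> hd (butlast q @ [u, v]) = r"
      using q qn uv assms(2)
      by (cases q rule: rev_cases)
        (auto simp: graph_walk_def successively_append_iff hd_append split: if_splits)
    then show ?thesis by (auto simp: tree_arcs_def)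
  next
    case True
    then obtain as bs where "q = as @ v # bs" by (meson split_list)
    moreover from this have "u \<in> set bs" using q uv by (auto split: if_splits)
    ultimately have "graph_walk V E (as @ [v, u]) \<and> distinct (as @ [v, u]) \<and> hd (as @ [v, u]) = r"
      using q uv assms(2)
      by (auto simp: graph_walk_def successively_append_iff successively_Cons hd_append insert_commute split: if_splits)
    then show ?thesis by (auto simp: tree_arcs_def)
  qed
qed

text \<open>Leaves are the vertices without children; this also covers the tree with a single vertex,
  whose root counts as a leaf.\<close>

lemma tree_leaves_eq:
  assumes "rooted_tree V E r"
  shows "tree_leaves V E r = {v \<in> V. \<nexists>w. (v, w) \<in> tree_arcs V E r}"
proof (cases "V = {r}")
  case True
  have "(r, w) \<notin> tree_arcs V E r" for w using tree_arcs_edge[of r w V E r] True by auto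
  then show ?thesis using True by (auto simp: tree_leaves_def)
next
  case False
  have "(v \<noteq> r \<and> (\<exists>!u. {u, v} \<in> E)) \<longleftrightarrow> (\<nexists>w. (v, w) \<in> tree_arcs V E r)" if v: "v \<in> V" for v
  proof (cases "v = r")
    case True
    obtain w where "w \<in> V" "w \<noteq> r" using False rooted_tree_facts(2)[OF assms] by blast
    then have "(r, w) \<in> (tree_arcs V E r)\<^sup>*" "w \<noteq> r" using root_ancestor[OF assms] by auto
    then show ?thesis using True by (metis converse_rtranclE)
  next
    case vr: False
    obtain u where u: "(u, v) \<in> tree_arcs V E r"
      using tree_arcs_parent_ex[OF assms v vr] by auto
    have 1: "(v, u) \<notin> tree_arcs V E r"
    proof
      assume "(v, u) \<in> tree_arcs V E r"
      then have loop: "u' = u \<or> u' = v" if "(u', w) \<in> tree_arcs V E r" "w = u \<or> w = v" for u' w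
        using tree_arcs_unique[OF assms] that u by blast
      \<comment> \<open>Following parents from \<open>v\<close> would never reach the root.\<close>
      have "w = u \<or> w = v" if "(w, v) \<in> (tree_arcs V E r)\<^sup>*" for w
        using that by (induction rule: converse_rtrancl_induct) (use loop in blast)+
      then have "r = u \<or> r = v" using root_ancestor[OF assms v] by blast
      then show False using vr u \<open>(v, u) \<in> _\<close> tree_arcs_edge(4) by metis
    qed
    show ?thesis
    proof
      assume "v \<noteq> r \<and> (\<exists>!u. {u, v} \<in> E)"
      then show "\<nexists>w. (v, w) \<in> tree_arcs V E r"
        using 1 u tree_arcs_edge(1) by (metis insert_commute)
    next
      assume *: "\<nexists>w. (v, w) \<in> tree_arcs V E r"
      have "{u', v} \<in> E \<Longrightarrow> u' = u" for u'
        using edge_is_arc[OF assms] * u tree_arcs_unique[OF assms] by metis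
      then show "v \<noteq> r \<and> (\<exists>!u. {u, v} \<in> E)" using vr u tree_arcs_edge(1) by metis
    qed
  qed
  then have "{v \<in> V. v \<noteq> r \<and> (\<exists>!u. {u, v} \<in> E)} = {v \<in> V. \<nexists>w. (v, w) \<in> tree_arcs V E r}"
    by (intro Collect_cong conj_cong refl)
  then show ?thesis using False by (simp add: tree_leaves_def)
qed

lemma arcs_rtrancl_in_V:
  assumes "(u, v) \<in> (tree_arcs V E r)\<^sup>*" "v \<in> V"
  shows "u \<in> V"
  using assms by (metis converse_rtranclE tree_arcs_edge(2))

lemma ancestors_chain:
  assumes "rooted_tree V E r"
    and "(u, v) \<in> (tree_arcs V E r)\<^sup>*" "(w, v) \<in> (tree_arcs V E r)\<^sup>*"
  shows "(u, w) \<in> (tree_arcs V E r)\<^sup>* \<or> (w, u) \<in> (tree_arcs V E r)\<^sup>*"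
  using assms(2,3)
proof (induction arbitrary: w rule: rtrancl_induct)
  case (step y z)
  from step.prems show ?case
  proof (cases rule: rtranclE)
    case base
    then show ?thesis using step by (meson rtrancl.rtrancl_into_rtrancl)
  next
    case (step y')
    then have "y' = y" using tree_arcs_unique[OF assms(1)] \<open>(y, z) \<in> _\<close> by blast
    then show ?thesis using step step.IH by blast
  qed
qed auto

text \<open>A function that strictly decreases along the arcs, such as the gauge, yields
  antisymmetry of the ancestor relation, and hence existence and uniqueness of lowest common
  ancestors.\<close>

lemma arcs_rtrancl_mono:
  fixes h :: "'v \<Rightarrow> real"
  assumes "\<And>u v. (u, v) \<in> A \<Longrightarrow> h v < h u" and "(u, v) \<in> A\<^sup>*"
  shows "h v < h u \<or> u = v"
  using assms(2)
proof (induction rule: rtrancl_induct)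
  case (step y z)
  then show ?case using assms(1)[of y z] by auto
qed auto

lemma LCA_characterization:
  fixes h :: "'v \<Rightarrow> real"
  assumes tree: "rooted_tree V E r"
    and h: "\<And>u v. (u, v) \<in> tree_arcs V E r \<Longrightarrow> h v < h u"
    and "v \<in> V" "w \<in> V"
  shows "\<And>b. (b, LCA V E r v w) \<in> (tree_arcs V E r)\<^sup>*
      \<longleftrightarrow> (b, v) \<in> (tree_arcs V E r)\<^sup>* \<and> (b, w) \<in> (tree_arcs V E r)\<^sup>*"
    and "LCA V E r v w \<in> V"
proof -
  let ?A = "(tree_arcs V E r)\<^sup>*"
  define B where "B = {b. (b, v) \<in> ?A \<and> (b, w) \<in> ?A}"
  have BV: "B \<subseteq> V" using arcs_rtrancl_in_V \<open>v \<in> V\<close> by (fastforce simp: B_def)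
  then have fin: "finite B" using rooted_tree_facts(1)[OF tree] finite_subset by blast
  have "r \<in> B" using root_ancestor[OF tree] assms by (auto simp: B_def)
  then obtain a where a: "a \<in> B" and amin: "\<And>b. b \<in> B \<Longrightarrow> h a \<le> h b"
    using fin arg_min_if_finite[of B h]
    by (metis arg_min_least empty_iff)
  have ab: "(b, a) \<in> ?A" if "b \<in> B" for b
  proof -
    have "(a, b) \<in> ?A \<or> (b, a) \<in> ?A"
      using a that ancestors_chain[OF tree] by (fastforce simp: B_def)
    then show ?thesis
      using arcs_rtrancl_mono[of "tree_arcs V E r" h a b] h amin[OF that] by auto
  qed
  have eq: "LCA V E r v w = a"
    unfolding LCA_def
  proof (rule the_equality)
    show "descendant V E r a v \<and> descendant V E r a w \<and>
        (\<forall>b. descendant V E r b v \<and> descendant V E r b w \<longrightarrow> descendant V E r b a)"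
      using a ab BV assms(3,4) by (auto simp: descendant_def B_def)
  next
    fix a' assume a': "descendant V E r a' v \<and> descendant V E r a' w \<and>
        (\<forall>b. descendant V E r b v \<and> descendant V E r b w \<longrightarrow> descendant V E r b a')"
    then have "(a, a') \<in> ?A" "(a', a) \<in> ?A"
      using a ab BV assms(3,4) by (auto simp: descendant_def B_def)
    then show "a' = a"
      using arcs_rtrancl_mono[of "tree_arcs V E r" h a a']
        arcs_rtrancl_mono[of "tree_arcs V E r" h a' a] h by fastforce
  qed
  show "(b, LCA V E r v w) \<in> ?A \<longleftrightarrow> (b, v) \<in> ?A \<and> (b, w) \<in> ?A" for b
    using a ab[of b] unfolding eq B_def by (auto intro: rtrancl_trans)
  show "LCA V E r v w \<in> V" using a BV eq by auto
qed

lemma leaf_descendant_ex: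
  fixes h :: "'v \<Rightarrow> real"
  assumes tree: "rooted_tree V E r"
    and h: "\<And>u v. (u, v) \<in> tree_arcs V E r \<Longrightarrow> h v < h u"
    and "v \<in> V"
  shows "\<exists>l\<in>tree_leaves V E r. (v, l) \<in> (tree_arcs V E r)\<^sup>*"
proof -
  let ?A = "(tree_arcs V E r)\<^sup>*"
  define D where "D = {w \<in> V. (v, w) \<in> ?A}"
  have "finite D" "v \<in> D" using rooted_tree_facts(1)[OF tree] assms(3) by (auto simp: D_def)
  then obtain l where l: "l \<in> D" and lmin: "\<And>b. b \<in> D \<Longrightarrow> h l \<le> h b"
    using arg_min_if_finite[of D h] by (metis arg_min_least empty_iff)
  have "(l, w) \<notin> tree_arcs V E r" for w
  proof
    assume lw: "(l, w) \<in> tree_arcs V E r"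
    then have "w \<in> D" using l tree_arcs_edge[OF lw] by (auto simp: D_def intro: rtrancl_into_rtrancl)
    then show False using lmin[of w] h[OF lw] by simp
  qed
  then show ?thesis using l by (auto simp: tree_leaves_eq[OF tree] D_def)
qed

section \<open>Gauged spaces covered by finitely many branches\<close>

text \<open>A branch system on a gauged space \<open>(Z, p)\<close> is a family of continuous sections
  \<open>\<gamma> i\<close> of the gauge \<open>p\<close>, each defined on a half-line \<open>{c i..}\<close>, that have closed images and
  cover \<open>Z\<close>, and that never separate again once they have met.  For a merge tree or a
  cellular merge tree \<open>\<gamma> i\<close> climbs from the \<open>i\<close>-th leaf to infinity.\<close>

definition branch_system ::
  "'z topology \<Rightarrow> ('z \<Rightarrow> real) \<Rightarrow> 'i set \<Rightarrow> ('i \<Rightarrow> real) \<Rightarrow> ('i \<Rightarrow> real \<Rightarrow> 'z) \<Rightarrow> bool" where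
  "branch_system Z p I c \<gamma> \<longleftrightarrow>
     finite I \<and> continuous_map Z euclideanreal p \<and>
     (\<forall>i\<in>I. continuous_map (top_of_set {c i..}) Z (\<gamma> i) \<and> closedin Z (\<gamma> i ` {c i..}) \<and>
        (\<forall>t\<ge>c i. p (\<gamma> i t) = t)) \<and>
     topspace Z = (\<Union>i\<in>I. \<gamma> i ` {c i..}) \<and>
     (\<forall>i\<in>I. \<forall>j\<in>I. \<forall>s t. c i \<le> s \<and> c j \<le> s \<and> s \<le> t \<and> \<gamma> i s = \<gamma> j s \<longrightarrow> \<gamma> i t = \<gamma> j t)"

lemma branch_systemD:
  assumes "branch_system Z p I c \<gamma>"
  shows "finite I" "continuous_map Z euclideanreal p"
    "\<And>i. i \<in> I \<Longrightarrow> continuous_map (top_of_set {c i..}) Z (\<gamma> i)"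
    "\<And>i. i \<in> I \<Longrightarrow> closedin Z (\<gamma> i ` {c i..})"
    "\<And>i t. i \<in> I \<Longrightarrow> c i \<le> t \<Longrightarrow> p (\<gamma> i t) = t"
    "topspace Z = (\<Union>i\<in>I. \<gamma> i ` {c i..})"
    "\<And>i j s t. i \<in> I \<Longrightarrow> j \<in> I \<Longrightarrow> c i \<le> s \<Longrightarrow> c j \<le> s \<Longrightarrow> s \<le> t \<Longrightarrow> \<gamma> i s = \<gamma> j s \<Longrightarrow> \<gamma> i t = \<gamma> j t"
    "\<And>i t. i \<in> I \<Longrightarrow> c i \<le> t \<Longrightarrow> \<gamma> i t \<in> topspace Z"
  using assms unfolding branch_system_def by blast+

lemma branch_systemE:
  assumes "branch_system Z p I c \<gamma>" "z \<in> topspace Z"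
  obtains i where "i \<in> I" "c i \<le> p z" "z = \<gamma> i (p z)"
  using assms branch_systemD(5,6)[OF assms(1)] by force

text \<open>The topology is determined by the branches: \<open>A\<close> is the union of its intersections with
  the branches, and each of these is cut out of the branch by a closed condition on the gauge.\<close>

lemma branch_system_closedin:
  assumes bs: "branch_system Z p I c \<gamma>" and "A \<subseteq> topspace Z"
    and cl: "\<And>i. i \<in> I \<Longrightarrow> closed {t. c i \<le> t \<and> \<gamma> i t \<in> A}"
  shows "closedin Z A"
proof -
  note b = branch_systemD[OF bs]
  have "closedin Z (\<gamma> i ` {c i..} \<inter> {z \<in> topspace Z. p z \<in> {t. c i \<le> t \<and> \<gamma> i t \<in> A}})" if "i \<in> I" for i
    by (intro closedin_Int closedin_continuous_map_preimage[OF b(2)] b(4)[OF that])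
      (simp add: cl[OF that])
  moreover have "A = (\<Union>i\<in>I. \<gamma> i ` {c i..} \<inter> {z \<in> topspace Z. p z \<in> {t. c i \<le> t \<and> \<gamma> i t \<in> A}})"
    (is "_ = ?U")
  proof
    show "A \<subseteq> ?U"
    proof
      fix z assume z: "z \<in> A"
      then have zt: "z \<in> topspace Z" using assms(2) by blast
      from branch_systemE[OF bs zt] obtain i where i: "i \<in> I" "c i \<le> p z" "z = \<gamma> i (p z)" .
      moreover have "z \<in> \<gamma> i ` {c i..}" using i(2,3) by (metis atLeast_iff imageI)
      ultimately show "z \<in> ?U" using z zt i(1) by (intro UN_I[of i]) simp_all
    qed
    show "?U \<subseteq> A" using b(5) by auto
  qed
  ultimately show ?thesis using closedin_Union[of "(\<lambda>i. \<gamma> i ` {c i..} \<inter> {z \<in> topspace Z. p z \<in> {t. c i \<le> t \<and> \<gamma> i t \<in> A}}) ` I"] b(1)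
    by (metis (no_types, lifting) closedin_Union finite_imageI imageE)
qed

text \<open>A map that carries the branches of one system to those of another is continuous, whether
  or not it is injective.\<close>

lemma branch_map_continuous:
  assumes bs: "branch_system Z p I c \<gamma>" and bs': "branch_system W q I c \<delta>"
    and eq: "\<And>i t. i \<in> I \<Longrightarrow> c i \<le> t \<Longrightarrow> \<phi> (\<gamma> i t) = \<delta> i t"
  shows "continuous_map Z W \<phi>"
  unfolding continuous_map_closedin
proof (intro conjI allI impI ballI Pi_I)
  note b = branch_systemD[OF bs] and b' = branch_systemD[OF bs']
  fix z assume "z \<in> topspace Z"
  then obtain i t where "i \<in> I" "c i \<le> t" "z = \<gamma> i t" using b(6) by auto
  then show "\<phi> z \<in> topspace W" using b'(8) eq by auto
next
  note b = branch_systemD[OF bs] and b' = branch_systemD[OF bs']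
  fix B assume B: "closedin W B"
  show "closedin Z {z \<in> topspace Z. \<phi> z \<in> B}"
  proof (rule branch_system_closedin[OF bs])
    fix i assume i: "i \<in> I"
    have "closedin (top_of_set {c i..}) {t \<in> topspace (top_of_set {c i..}). \<delta> i t \<in> B}"
      using b'(3)[OF i] B by (rule closedin_continuous_map_preimage)
    then have "closed {t \<in> {c i..}. \<delta> i t \<in> B}" using closedin_closed_trans by force
    moreover have "{t. c i \<le> t \<and> \<gamma> i t \<in> {z \<in> topspace Z. \<phi> z \<in> B}} = {t \<in> {c i..}. \<delta> i t \<in> B}"
      using i eq b(8) by auto
    ultimately show "closed {t. c i \<le> t \<and> \<gamma> i t \<in> {z \<in> topspace Z. \<phi> z \<in> B}}" by simp
  qed auto
qed

lemma branch_map_ex: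
  assumes bs: "branch_system Z p I c \<gamma>" and bs': "branch_system W q I c \<delta>"
    and eq: "\<And>i j t. i \<in> I \<Longrightarrow> j \<in> I \<Longrightarrow> c i \<le> t \<Longrightarrow> c j \<le> t \<Longrightarrow> \<gamma> i t = \<gamma> j t \<Longrightarrow> \<delta> i t = \<delta> j t"
  shows "\<exists>\<phi>. \<forall>i\<in>I. \<forall>t\<ge>c i. \<phi> (\<gamma> i t) = \<delta> i t"
proof -
  note b = branch_systemD[OF bs]
  \<comment> \<open>Follow any branch through \<open>z\<close>; by \<open>eq\<close> the choice does not affect the image.\<close>
  define idx where "idx z = (SOME i. i \<in> I \<and> c i \<le> p z \<and> z = \<gamma> i (p z))" for z
  have "\<delta> (idx (\<gamma> i t)) (p (\<gamma> i t)) = \<delta> i t" if "i \<in> I" "c i \<le> t" for i t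
  proof -
    have "\<exists>j. j \<in> I \<and> c j \<le> p (\<gamma> i t) \<and> \<gamma> i t = \<gamma> j (p (\<gamma> i t))"
      using that b(5) by auto
    from someI_ex[OF this] have "idx (\<gamma> i t) \<in> I \<and> c (idx (\<gamma> i t)) \<le> t \<and> \<gamma> i t = \<gamma> (idx (\<gamma> i t)) t"
      using b(5) that by (simp add: idx_def)
    then show ?thesis using eq[of i "idx (\<gamma> i t)" t] that b(5) by metis
  qed
  then show ?thesis by (intro exI[of _ "\<lambda>z. \<delta> (idx z) (p z)"]) auto
qed

text \<open>Two gauged spaces whose branches start at the same heights and coincide at the same
  heights are isomorphic.\<close>

lemma branch_system_isomorphic:
  assumes bs: "branch_system Z p I c \<gamma>" and bs': "branch_system W q I c \<delta>"
    and eq: "\<And>i j t. i \<in> I \<Longrightarrow> j \<in> I \<Longrightarrow> c i \<le> t \<Longrightarrow> c j \<le> t \<Longrightarrow> \<gamma> i t = \<gamma> j t \<longleftrightarrow> \<delta> i t = \<delta> j t"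
  shows "gauged_isomorphic Z p W q"
proof -
  note b = branch_systemD[OF bs] and b' = branch_systemD[OF bs']
  have "\<exists>\<phi>. \<forall>i\<in>I. \<forall>t\<ge>c i. \<phi> (\<gamma> i t) = \<delta> i t"
    by (rule branch_map_ex[OF bs bs']) (simp add: eq)
  then obtain \<phi> where \<phi>: "\<And>i t. i \<in> I \<Longrightarrow> c i \<le> t \<Longrightarrow> \<phi> (\<gamma> i t) = \<delta> i t" by metis
  have "\<exists>\<psi>. \<forall>i\<in>I. \<forall>t\<ge>c i. \<psi> (\<delta> i t) = \<gamma> i t"
    by (rule branch_map_ex[OF bs' bs]) (simp add: eq)
  then obtain \<psi> where \<psi>: "\<And>i t. i \<in> I \<Longrightarrow> c i \<le> t \<Longrightarrow> \<psi> (\<delta> i t) = \<gamma> i t" by metis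
  have "homeomorphic_maps Z W \<phi> \<psi>"
    unfolding homeomorphic_maps_def
    using branch_map_continuous[OF bs bs' \<phi>] branch_map_continuous[OF bs' bs \<psi>]
    by (auto simp: b(6) b'(6) \<phi> \<psi>)
  then have "homeomorphic_map Z W \<phi>" using homeomorphic_map_maps by blast
  moreover have "p z = q (\<phi> z)" if z: "z \<in> topspace Z" for z
  proof -
    from branch_systemE[OF bs z] obtain i where i: "i \<in> I" "c i \<le> p z" "z = \<gamma> i (p z)" .
    have "\<phi> z = \<delta> i (p z)" by (subst i(3)) (rule \<phi>[OF i(1,2)])
    then show ?thesis using b'(5)[OF i(1,2)] by simp
  qed
  ultimately show ?thesis unfolding gauged_isomorphic_def by blast
qed

lemma branch_system_transport:
  assumes bs: "branch_system W q I c \<delta>" and iso: "gauged_isomorphic Z p W q"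
  shows "\<exists>\<gamma>. branch_system Z p I c \<gamma> \<and>
    (\<forall>i\<in>I. \<forall>j\<in>I. \<forall>s t. c i \<le> s \<and> c j \<le> t \<longrightarrow> (\<gamma> i s = \<gamma> j t \<longleftrightarrow> \<delta> i s = \<delta> j t))"
proof -
  note b = branch_systemD[OF bs]
  obtain \<phi> where "homeomorphic_map Z W \<phi>" and pq: "\<And>z. z \<in> topspace Z \<Longrightarrow> p z = q (\<phi> z)"
    using iso by (auto simp: gauged_isomorphic_def)
  then obtain \<psi> where hm: "homeomorphic_maps Z W \<phi> \<psi>" using homeomorphic_map_maps by blast
  then have cont: "continuous_map Z W \<phi>" "continuous_map W Z \<psi>"
    and inv: "\<And>z. z \<in> topspace Z \<Longrightarrow> \<psi> (\<phi> z) = z" "\<And>w. w \<in> topspace W \<Longrightarrow> \<phi> (\<psi> w) = w"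
    by (auto simp: homeomorphic_maps_def)
  have hpsi: "homeomorphic_map W Z \<psi>" using hm homeomorphic_maps_map by blast
  define \<gamma> where "\<gamma> i t = \<psi> (\<delta> i t)" for i t
  have \<psi>Z: "\<psi> w \<in> topspace Z" if "w \<in> topspace W" for w
    using cont(2) that by (auto simp: continuous_map_def)
  have \<gamma>\<phi>: "\<phi> (\<gamma> i t) = \<delta> i t" if "i \<in> I" "c i \<le> t" for i t
    using that b(8) inv by (simp add: \<gamma>_def)
  have eq: "\<gamma> i s = \<gamma> j t \<longleftrightarrow> \<delta> i s = \<delta> j t" if "i \<in> I" "j \<in> I" "c i \<le> s" "c j \<le> t" for i j s t
    using \<gamma>\<phi> that by (metis \<gamma>_def)
  have "branch_system Z p I c \<gamma>"
    unfolding branch_system_def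
  proof (intro conjI ballI allI impI)
    show "finite I" by (rule b)
    have "continuous_map Z euclideanreal (q \<circ> \<phi>)" using cont(1) b(2) by (rule continuous_map_compose)
    then show "continuous_map Z euclideanreal p"
      by (rule continuous_map_eq) (simp add: pq)
  next
    fix i assume i: "i \<in> I"
    have "continuous_map (top_of_set {c i..}) Z (\<psi> \<circ> \<delta> i)"
      using b(3)[OF i] cont(2) by (rule continuous_map_compose)
    then show "continuous_map (top_of_set {c i..}) Z (\<gamma> i)"
      by (simp add: \<gamma>_def[abs_def] comp_def)
    have "\<gamma> i ` {c i..} = \<psi> ` (\<delta> i ` {c i..})" by (simp add: \<gamma>_def image_image)
    moreover have "closedin Z (\<psi> ` (\<delta> i ` {c i..}))"
      using b(4)[OF i] hpsi homeomorphic_imp_closed_map unfolding closed_map_def by blast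
    ultimately show "closedin Z (\<gamma> i ` {c i..})" by simp
    fix t assume "c i \<le> t"
    then show "p (\<gamma> i t) = t" using i \<psi>Z pq \<gamma>\<phi> b(5,8) by (simp add: \<gamma>_def)
  next
    have "topspace Z = \<psi> ` topspace W" using hpsi homeomorphic_imp_surjective_map by blast
    then show "topspace Z = (\<Union>i\<in>I. \<gamma> i ` {c i..})"
      unfolding b(6) by (auto simp: \<gamma>_def)
  next
    fix i j s t assume "i \<in> I" "j \<in> I" "c i \<le> s \<and> c j \<le> s \<and> s \<le> t \<and> \<gamma> i s = \<gamma> j s"
    then show "\<gamma> i t = \<gamma> j t" using eq[of i j s s] eq[of i j t t] b(7)[of i j s t] by auto
  qed
  then show ?thesis using eq by blast
qed

text \<open>A continuous section of the gauge that starts on a branch stays on that branch.  Below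
  the level \<open>t\<close> the space is the disjoint union of two closed sets, the branches that agree with
  \<open>\<gamma> i\<close> at the height \<open>t\<close> and those that do not, and the section cannot cross between them.\<close>

lemma section_follows_branch:
  assumes bs: "branch_system Z p I c \<gamma>"
    and cont: "continuous_map (top_of_set {a..}) Z \<sigma>"
    and sec: "\<And>t. a \<le> t \<Longrightarrow> p (\<sigma> t) = t"
    and i: "i \<in> I" "c i \<le> a" "\<sigma> a = \<gamma> i a" and "a \<le> t"
  shows "\<sigma> t = \<gamma> i t"
proof -
  note b = branch_systemD[OF bs]
  define W where "W J = (\<Union>j\<in>J. \<gamma> j ` {c j..} \<inter> {z \<in> topspace Z. p z \<in> {..t}})" for J
  have "closedin Z (\<gamma> j ` {c j..} \<inter> {z \<in> topspace Z. p z \<in> {..t}})" if "j \<in> I" for j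
    by (intro closedin_Int closedin_continuous_map_preimage[OF b(2)] b(4)[OF that]) simp
  then have clW: "closedin Z (W J)" if "J \<subseteq> I" for J
    using that b(1) unfolding W_def by (intro closedin_Union) (auto intro: finite_subset)
  define J where "J = {j \<in> I. c j \<le> t \<and> \<gamma> j t = \<gamma> i t}"
  define P where "P J = {s \<in> {a..}. \<sigma> s \<in> W J} \<inter> {..t}" for J
  have clP: "closed (P J)" if "J \<subseteq> I" for J
  proof -
    have "closedin (top_of_set {a..}) {s \<in> topspace (top_of_set {a..}). \<sigma> s \<in> W J}"
      using cont clW[OF that] by (rule closedin_continuous_map_preimage)
    then have "closed {s \<in> {a..}. \<sigma> s \<in> W J}" using closedin_closed_trans by force
    then show ?thesis unfolding P_def by (rule closed_Int) simp
  qed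
  have \<sigma>Z: "\<sigma> s \<in> topspace Z" if "a \<le> s" for s
    using cont that by (auto simp: continuous_map_def)
  have inW: "\<sigma> s \<in> W J'" if "j \<in> J'" "c j \<le> s" "a \<le> s" "s \<le> t" "\<sigma> s = \<gamma> j s" for j s J'
    using that(1,2,4,5) \<sigma>Z[OF that(3)] sec[OF that(3)] unfolding W_def
    by (intro UN_I[of j]) auto
  have dis: "W J \<inter> W (I - J) = {}"
  proof (rule ccontr)
    assume "W J \<inter> W (I - J) \<noteq> {}"
    then obtain z where z: "z \<in> W J" "z \<in> W (I - J)" by blast
    from z(1) obtain j s where "j \<in> J" "c j \<le> s" "z = \<gamma> j s" "p z \<le> t"
      unfolding W_def by auto
    moreover from z(2) obtain k s' where "k \<in> I - J" "c k \<le> s'" "z = \<gamma> k s'"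
      unfolding W_def by auto
    ultimately have jk: "j \<in> J" "k \<in> I - J" "c j \<le> s" "c k \<le> s'" "\<gamma> j s = \<gamma> k s'"
      "p (\<gamma> j s) \<le> t" by auto
    have jI: "j \<in> I" and kI: "k \<in> I" using jk by (auto simp: J_def)
    have "s = s'" "s \<le> t" using jk b(5)[OF jI, of s] b(5)[OF kI, of s'] by auto
    then have "\<gamma> k t = \<gamma> j t" using b(7)[OF kI jI, of s t] jk by auto
    then show False using jk \<open>s = s'\<close> \<open>s \<le> t\<close> by (auto simp: J_def)
  qed
  have "P J \<inter> {a..t} = {} \<or> P (I - J) \<inter> {a..t} = {}"
  proof (rule connected_closedD)
    show "connected {a..t}" by simp
    show "P J \<inter> P (I - J) \<inter> {a..t} = {}" using dis by (auto simp: P_def)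
    show "{a..t} \<subseteq> P J \<union> P (I - J)"
    proof
      fix s assume s: "s \<in> {a..t}"
      then obtain j where j: "j \<in> I" "c j \<le> p (\<sigma> s)" "\<sigma> s = \<gamma> j (p (\<sigma> s))"
        using branch_systemE[OF bs \<sigma>Z[of s]] by auto
      then have "c j \<le> s" "\<sigma> s = \<gamma> j s" using s sec by auto
      then have "\<sigma> s \<in> W J \<or> \<sigma> s \<in> W (I - J)" using inW[of j J s] inW[of j "I - J" s] j(1) s by auto
      then show "s \<in> P J \<union> P (I - J)" using s by (auto simp: P_def)
    qed
  qed (use clP in \<open>auto simp: J_def\<close>)
  moreover have "a \<in> P J \<inter> {a..t}"
    using inW[of i J a] i \<open>a \<le> t\<close> by (auto simp: P_def J_def)
  moreover obtain j where j: "j \<in> I" "c j \<le> p (\<sigma> t)" "\<sigma> t = \<gamma> j (p (\<sigma> t))"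
    using branch_systemE[OF bs \<sigma>Z[OF \<open>a \<le> t\<close>]] by auto
  ultimately have "j \<in> J"
    using inW[of j "I - J" t] \<open>a \<le> t\<close> sec[OF \<open>a \<le> t\<close>] by (auto simp: P_def)
  then show ?thesis using j sec[OF \<open>a \<le> t\<close>] by (simp add: J_def)
qed

section \<open>The branches of a merge tree\<close>

text \<open>\<open>joined X f t x y\<close>: the points \<open>x\<close> and \<open>y\<close> lie in the same connected component of the
  sublevel set at level \<open>t\<close>.  In particular both values are at most \<open>t\<close>.\<close>

abbreviation joined :: "'a topology \<Rightarrow> ('a \<Rightarrow> real) \<Rightarrow> real \<Rightarrow> 'a \<Rightarrow> 'a \<Rightarrow> bool" where
  "joined X f t \<equiv> connected_component_of (subtopology X (sublevel X f t))"

lemma joinedD: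
  assumes "joined X f t x y"
  shows "x \<in> topspace X" "y \<in> topspace X" "f x \<le> t" "f y \<le> t"
  using connected_component_in_topspace[OF assms] by (auto simp: sublevel_def)

lemma joined_refl: "x \<in> topspace X \<Longrightarrow> f x \<le> t \<Longrightarrow> joined X f t x x"
  by (simp add: connected_component_of_refl sublevel_def)

lemma joined_mono:
  assumes "joined X f s x y" "s \<le> t"
  shows "joined X f t x y"
proof -
  have "sublevel X f s \<subseteq> sublevel X f t" using assms(2) by (auto simp: sublevel_def)
  then show ?thesis using assms(1) connected_component_of_mono by metis
qed

lemma joined_connectedin:
  assumes "connectedin X S" "S \<subseteq> sublevel X f t" "x \<in> S" "y \<in> S"
  shows "joined X f t x y"
  using assms by (auto simp: connected_component_of_def connectedin_subtopology)

lemma merge_class_eq: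
  assumes "(x, t) \<in> epigraph_of X f" "(y, s) \<in> epigraph_of X f"
  shows "merge_rel X f `` {(x, t)} = merge_rel X f `` {(y, s)} \<longleftrightarrow> t = s \<and> joined X f t x y"
  using eq_equiv_class_iff[OF equiv_merge_rel assms] by (auto simp: merge_rel_def)

lemma topspace_merge_tree: "topspace (merge_tree X f) = epigraph_of X f // merge_rel X f"
  by (simp add: merge_tree_def del: topspace_subtopology)

lemma merge_class_in: "(x, t) \<in> epigraph_of X f \<Longrightarrow> merge_rel X f `` {(x, t)} \<in> topspace (merge_tree X f)"
  by (simp add: topspace_merge_tree quotientI)

lemma merge_tree_pointE:
  assumes "z \<in> topspace (merge_tree X f)"
  obtains x t where "(x, t) \<in> epigraph_of X f" "z = merge_rel X f `` {(x, t)}"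
    "merge_tree_gauge z = t"
  using assms merge_tree_gauge_class by (fastforce simp: topspace_merge_tree elim!: quotientE)

lemma quotient_map_merge_tree:
  "quotient_map (subtopology (prod_topology X euclideanreal) (epigraph_of X f)) (merge_tree X f)
     (\<lambda>q. merge_rel X f `` {q})"
  unfolding merge_tree_def by (rule quotient_map_quotient_topology)

lemma continuous_map_gauge: "continuous_map (merge_tree X f) euclideanreal merge_tree_gauge"
  using gauged_space_merge_tree by (simp add: gauged_space_def)

lemma continuous_map_branch:
  assumes "x \<in> topspace X"
  shows "continuous_map (top_of_set {f x..}) (merge_tree X f) (\<lambda>t. merge_rel X f `` {(x, t)})"
proof -
  have "continuous_map (top_of_set {f x..})
      (subtopology (prod_topology X euclideanreal) (epigraph_of X f)) (\<lambda>t. (x, t))"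
    using assms by (auto simp: continuous_map_in_subtopology epigraph_of_def
        intro!: continuous_map_pairedI)
  then have "continuous_map (top_of_set {f x..}) (merge_tree X f)
      ((\<lambda>q. merge_rel X f `` {q}) \<circ> (\<lambda>t. (x, t)))"
    using quotient_imp_continuous_map[OF quotient_map_merge_tree] by (rule continuous_map_compose)
  then show ?thesis by (simp add: comp_def)
qed

text \<open>In a compact Hausdorff space the components of a sublevel set are its quasi-components, so
  points of different components are separated by a partition into two closed sets.  These have
  disjoint neighbourhoods, whose union still contains the sublevel sets at slightly higher
  levels.  Hence being joined to a fixed point is a closed condition on point and level.\<close>

lemma closedin_joined:
  assumes comp: "compact_space X" and haus: "Hausdorff_space X"
    and f: "continuous_map X euclideanreal f"
  shows "closedin (prod_topology X euclideanreal) {(y, t). joined X f t x y}"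
proof -
  let ?P = "prod_topology X euclideanreal"
  let ?G = "{(y, t). joined X f t x y}"
  have sub: "?G \<subseteq> topspace ?P" using joinedD(2) by fastforce
  have "\<exists>T. openin ?P T \<and> q \<in> T \<and> T \<subseteq> topspace ?P - ?G" if q: "q \<in> topspace ?P - ?G" for q
  proof -
    obtain y t where qyt: "q = (y, t)" by (cases q)
    have y: "y \<in> topspace X" and nj: "\<not> joined X f t x y" using q qyt by auto
    have opf: "openin X {z \<in> topspace X. f z \<in> S}" if "open S" for S
      using openin_continuous_map_preimage[OF f, of S] that by simp
    show ?thesis
    proof (cases "x \<in> topspace X \<and> f x \<le> t \<and> f y \<le> t")
      case False
      then consider "x \<notin> topspace X" | "f x > t" | "f y > t" by linarith
      then show ?thesis
      proof cases
        case 1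
        then have "?G = {}" using joinedD(1) by fastforce
        then show ?thesis using q openin_topspace[of ?P] by (intro exI[of _ "topspace ?P"]) (simp del: topspace_prod_topology)
      next
        case 2
        let ?T = "topspace X \<times> {..<f x}"
        have "openin ?P ?T" by (simp add: openin_prod_Times_iff)
        moreover have "?T \<inter> ?G = {}" using joinedD(3) by fastforce
        ultimately show ?thesis using y 2 qyt by (intro exI[of _ ?T]) auto
      next
        case 3
        let ?m = "(f y + t) / 2"
        let ?T = "{z \<in> topspace X. f z \<in> {?m<..}} \<times> {..<?m}"
        have "openin ?P ?T" using opf[of "{?m<..}"] by (simp add: openin_prod_Times_iff)
        moreover have "?T \<inter> ?G = {}" using joinedD(4) by fastforce
        ultimately show ?thesis using y 3 qyt by (intro exI[of _ ?T]) auto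
      qed
    next
      case True
      let ?S = "sublevel X f t"
      let ?Xt = "subtopology X ?S"
      have S: "?S \<subseteq> topspace X" by (auto simp: sublevel_def)
      have clS: "closedin X ?S"
        using closedin_continuous_map_preimage[OF f, of "{..t}"] by (simp add: sublevel_def)
      have "compact_space ?Xt" "Hausdorff_space ?Xt"
        using closedin_compact_space[OF comp clS] haus
        by (auto simp: compact_space_subtopology Hausdorff_space_subtopology)
      then have "quasi_component_of ?Xt x = connected_component_of ?Xt x"
        using quasi_eq_connected_components_of[of ?Xt] quasi_eq_connected_components_of_pointwise_alt[of ?Xt]
        by blast
      then have "\<not> quasi_component_of ?Xt x y" using nj by simp
      moreover have xy: "x \<in> topspace ?Xt" "y \<in> topspace ?Xt"
        using True y by (auto simp: sublevel_def)
      ultimately obtain T where T: "x \<in> T" "closedin ?Xt T" "openin ?Xt T" "y \<notin> T"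
        unfolding quasi_component_of by blast
      have clA: "closedin X T" using T(2) clS closedin_trans_full by blast
      have "closedin ?Xt (topspace ?Xt - T)" using T(3) by (rule closedin_diff[OF closedin_topspace])
      then have clB: "closedin X (?S - T)" using clS S closedin_trans_full
        by (metis topspace_subtopology_subset)
      have "normal_space X" using comp haus compact_Hausdorff_or_regular_imp_normal_space by blast
      then obtain U W where UW: "openin X U" "openin X W" "T \<subseteq> U" "?S - T \<subseteq> W" "disjnt U W"
        using clA clB unfolding normal_space_def by (metis Diff_disjoint disjnt_def)
      let ?K = "topspace X - (U \<union> W)"
      have "closedin X ?K" using UW by blast
      then have "compactin X ?K" using comp closedin_compact_space by blast
      then have cK: "compact (f ` ?K)" using f image_compactin by fastforce
      have Kt: "v > t" if "v \<in> f ` ?K" for v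
        using that UW(3,4) by (force simp: sublevel_def)
      \<comment> \<open>By compactness \<open>f\<close> stays above some \<open>e > t\<close> outside the two neighbourhoods.\<close>
      obtain e where e: "e > t" "\<And>z. z \<in> ?K \<Longrightarrow> f z \<ge> e"
      proof (cases "?K = {}")
        case True
        then show ?thesis using that[of "t + 1"] by auto
      next
        case False
        then obtain v where "v \<in> f ` ?K" "\<And>w. w \<in> f ` ?K \<Longrightarrow> v \<le> w"
          using compact_attains_inf[OF cK] by blast
        then show ?thesis using that[of v] Kt by blast
      qed
      let ?T = "W \<times> {..<e}"
      have "openin ?P ?T" using UW(2) by (simp add: openin_prod_Times_iff)
      moreover have "y \<in> W" using UW(4) xy T(4) by auto
      moreover have "\<not> joined X f s x z" if z: "z \<in> W" "s < e" for z s
      proof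
        assume "joined X f s x z"
        then obtain C where C: "connectedin X C" "C \<subseteq> sublevel X f s" "x \<in> C" "z \<in> C"
          by (auto simp: connected_component_of_def connectedin_subtopology)
        have "C \<subseteq> U \<union> W" using C(2) e(2) z(2) by (fastforce simp: sublevel_def)
        moreover have "x \<in> U" using T(1) UW(3) by blast
        then have "U \<inter> C \<noteq> {}" "W \<inter> C \<noteq> {}" using C z by auto
        moreover have "U \<inter> W \<inter> C = {}" using UW(5) by (auto simp: disjnt_def)
        ultimately show False
          using C(1) UW(1,2) unfolding connectedin by metis
      qed
      ultimately show ?thesis using openin_subset[OF UW(2)] e(1) qyt by (intro exI[of _ ?T]) auto
    qed
  qed
  then have "openin ?P (topspace ?P - ?G)" by (subst openin_subopen) blast
  then show ?thesis using sub by (simp add: closedin_def)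
qed

text \<open>The preimage in the epigraph of the branch above \<open>x\<close> is the set just shown to be closed.\<close>

lemma closedin_branch:
  assumes "compact_space X" "Hausdorff_space X" "continuous_map X euclideanreal f"
    and x: "x \<in> topspace X"
  shows "closedin (merge_tree X f) ((\<lambda>t. merge_rel X f `` {(x, t)}) ` {f x..})"
proof -
  let ?E = "subtopology (prod_topology X euclideanreal) (epigraph_of X f)"
  let ?K = "(\<lambda>t. merge_rel X f `` {(x, t)}) ` {f x..}"
  have xE: "(x, t) \<in> epigraph_of X f" if "f x \<le> t" for t
    using that x by (simp add: epigraph_of_def)
  have "{q \<in> topspace ?E. merge_rel X f `` {q} \<in> ?K} = epigraph_of X f \<inter> {(y, t). joined X f t x y}"
  proof (intro set_eqI iffI)
    fix q assume "q \<in> {q \<in> topspace ?E. merge_rel X f `` {q} \<in> ?K}"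
    then show "q \<in> epigraph_of X f \<inter> {(y, t). joined X f t x y}"
      using merge_class_eq[OF xE] by (cases q) (auto simp del: topspace_subtopology)
  next
    fix q assume "q \<in> epigraph_of X f \<inter> {(y, t). joined X f t x y}"
    then obtain y t where q: "q = (y, t)" "(y, t) \<in> epigraph_of X f" "joined X f t x y" by auto
    have xt: "f x \<le> t" using q(3) joinedD(3) by metis
    then have "merge_rel X f `` {(x, t)} = merge_rel X f `` {q}"
      using merge_class_eq[OF xE[OF xt] q(2)] q by simp
    then have "merge_rel X f `` {q} \<in> ?K" using xt by auto
    then show "q \<in> {q \<in> topspace ?E. merge_rel X f `` {q} \<in> ?K}"
      using q by (simp del: topspace_subtopology)
  qed
  moreover have "closedin ?E (epigraph_of X f \<inter> {(y, t). joined X f t x y})"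
    using closedin_joined[OF assms(1-3)] closedin_subtopology_Int_closed by blast
  moreover have "?K \<subseteq> topspace (merge_tree X f)" using merge_class_in[OF xE] by auto
  ultimately show ?thesis
    using quotient_map_merge_tree[of X f] unfolding quotient_map_closedin by auto
qed

section \<open>Local minima\<close>

lemma common_value_eq:
  assumes "x \<in> M" and "\<And>y. y \<in> M \<Longrightarrow> f y = v"
  shows "common_value f M = v"
proof -
  have "f ` M = {v}" using assms by auto
  then show ?thesis by (simp add: common_value_def)
qed

text \<open>A local minimum is a component of the sublevel set at the level of one of its points on
  which \<open>f\<close> is constant.\<close>

lemma local_minima_iff:
  "M \<in> local_minima X f \<longleftrightarrow>
     (\<exists>x\<in>topspace X. M = Collect (joined X f (f x) x) \<and> (\<forall>y\<in>M. f y = f x))"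
proof
  assume "M \<in> local_minima X f"
  then have M: "M \<noteq> {}" "connectedin X M" "f constant_on M"
    "\<And>M'. connectedin X M' \<Longrightarrow> M \<subset> M' \<Longrightarrow> \<exists>x\<in>M'. f x > common_value f M"
    by (auto simp: local_minima_def)
  obtain x where x: "x \<in> M" using M(1) by blast
  have eq: "f y = f x" if "y \<in> M" for y using M(3) x that unfolding constant_on_def by metis
  have cv: "common_value f M = f x" using x eq by (rule common_value_eq)
  have MX: "M \<subseteq> topspace X" using M(2) connectedin_subset_topspace by blast
  let ?C = "Collect (joined X f (f x) x)"
  have "M \<subseteq> sublevel X f (f x)" using MX eq by (auto simp: sublevel_def)
  then have MC: "M \<subseteq> ?C" using joined_connectedin[OF M(2) _ x] by auto
  have "connectedin X ?C"
    using connectedin_connected_component_of[of "subtopology X (sublevel X f (f x))" x]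
    by (simp add: connectedin_subtopology)
  then have "M = ?C" using M(4)[of ?C] MC joinedD(4) unfolding cv
    by (metis leD mem_Collect_eq psubsetI)
  then show "\<exists>x\<in>topspace X. M = Collect (joined X f (f x) x) \<and> (\<forall>y\<in>M. f y = f x)"
    using x MX eq by blast
next
  assume "\<exists>x\<in>topspace X. M = Collect (joined X f (f x) x) \<and> (\<forall>y\<in>M. f y = f x)"
  then obtain x where x: "x \<in> topspace X" and M: "M = Collect (joined X f (f x) x)"
    and eq: "\<And>y. y \<in> M \<Longrightarrow> f y = f x" by blast
  have xM: "x \<in> M" using joined_refl[of x X f "f x"] x M by simp
  have "connectedin X M"
    using connectedin_connected_component_of[of "subtopology X (sublevel X f (f x))" x]
    by (simp add: connectedin_subtopology M)
  moreover have cv: "common_value f M = f x" using xM eq by (rule common_value_eq)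
  moreover have "\<exists>y\<in>M'. f y > f x" if M': "connectedin X M'" "M \<subset> M'" for M'
  proof (rule ccontr)
    assume "\<not> (\<exists>y\<in>M'. f y > f x)"
    then have "M' \<subseteq> sublevel X f (f x)"
      using connectedin_subset_topspace[OF M'(1)] by (auto simp: sublevel_def)
    then have "joined X f (f x) x y" if "y \<in> M'" for y
      using joined_connectedin[OF M'(1)] xM M'(2) that by blast
    then have "M' \<subseteq> M" unfolding M by blast
    then show False using M'(2) by blast
  qed
  ultimately show "M \<in> local_minima X f"
    using xM eq unfolding local_minima_def constant_on_def cv mem_Collect_eq
    by (intro conjI) (blast, assumption, metis, blast)
qed

lemma local_minimum_at:
  assumes "M \<in> local_minima X f" "x \<in> M"
  shows "x \<in> topspace X" "common_value f M = f x" "M = Collect (joined X f (f x) x)"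
    "\<And>y. y \<in> M \<Longrightarrow> f y = f x"
proof -
  obtain z where z: "z \<in> topspace X" "M = Collect (joined X f (f z) z)" "\<And>y. y \<in> M \<Longrightarrow> f y = f z"
    using assms(1) local_minima_iff by metis
  show eq: "\<And>y. y \<in> M \<Longrightarrow> f y = f x" using z(3) assms(2) by metis
  show "common_value f M = f x" using assms(2) eq by (rule common_value_eq)
  have j: "joined X f (f x) z x" using z assms(2) by auto
  then show "x \<in> topspace X" using joinedD by metis
  show "M = Collect (joined X f (f x) x)"
    using j z(2) z(3)[OF assms(2)] by (metis connected_component_of_eq joinedD(1) joinedD(2) connected_component_of_equiv)
qed

lemma local_minimum_nonempty: "M \<in> local_minima X f \<Longrightarrow> M \<noteq> {}"
  by (simp add: local_minima_def)

text \<open>Every component of a sublevel set contains a local minimum: the component, in its own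
  sublevel set, of a point where \<open>f\<close> is least.\<close>

lemma local_minimum_below:
  assumes comp: "compact_space X" and f: "continuous_map X euclideanreal f"
    and y: "y \<in> topspace X" "f y \<le> t"
  shows "\<exists>M\<in>local_minima X f. \<forall>x\<in>M. joined X f t x y"
proof -
  let ?S = "sublevel X f t"
  let ?C = "Collect (joined X f t y)"
  have clS: "closedin X ?S"
    using closedin_continuous_map_preimage[OF f, of "{..t}"] by (simp add: sublevel_def)
  have "closedin (subtopology X ?S) ?C" by (rule closedin_connected_component_of)
  then have "closedin X ?C" using clS closedin_trans_full by blast
  then have "compactin X ?C" using comp closedin_compact_space by blast
  then have "compact (f ` ?C)" using f image_compactin by fastforce
  moreover have yC: "y \<in> ?C" using joined_refl y by auto
  ultimately obtain v where v: "v \<in> f ` ?C" "\<And>w. w \<in> f ` ?C \<Longrightarrow> v \<le> w"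
    using compact_attains_inf[of "f ` ?C"] by blast
  then obtain z where z: "joined X f t y z" "v = f z" by auto
  let ?M = "Collect (joined X f (f z) z)"
  have up: "joined X f t y x" if "joined X f (f z) z x" for x
    using joined_mono[OF that] z joinedD(4)[OF z(1)] connected_component_of_trans by metis
  have "f x = f z" if "x \<in> ?M" for x
    using v(2)[of "f x"] up[of x] that joinedD(4)[of X f "f z" z x] z(2) by fastforce
  then have "?M \<in> local_minima X f"
    unfolding local_minima_iff using joinedD(2)[OF z(1)] by blast
  moreover have "\<forall>x\<in>?M. joined X f t x y" using up by (auto simp: connected_component_of_sym)
  ultimately show ?thesis by blast
qed

section \<open>Merge levels\<close>

lemma merge_level_iff_components:
  assumes "M \<in> local_minima X f" "N \<in> local_minima X f" "x \<in> M" "y \<in> N"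
  shows "(\<exists>C\<in>connected_components_of (subtopology X (sublevel X f t)). M \<subseteq> C \<and> N \<subseteq> C)
    \<longleftrightarrow> joined X f t x y"
proof
  assume "\<exists>C\<in>connected_components_of (subtopology X (sublevel X f t)). M \<subseteq> C \<and> N \<subseteq> C"
  then obtain C where C: "C \<in> connected_components_of (subtopology X (sublevel X f t))" "x \<in> C" "y \<in> C"
    using assms by blast
  then show "joined X f t x y"
    using connectedin_connected_components_of[OF C(1)] unfolding connected_component_of_def by blast
next
  assume j: "joined X f t x y"
  note x = local_minimum_at[OF assms(1,3)] and y = local_minimum_at[OF assms(2,4)]
  have "M \<subseteq> Collect (joined X f t x)"
  proof
    fix z assume "z \<in> M"
    then have "joined X f (f x) x z" by (subst (asm) x(3)) simp
    then show "z \<in> Collect (joined X f t x)" using joined_mono joinedD(3)[OF j] by auto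
  qed
  moreover have "N \<subseteq> Collect (joined X f t x)"
  proof
    fix z assume "z \<in> N"
    then have "joined X f (f y) y z" by (subst (asm) y(3)) simp
    then have "joined X f t y z" using joined_mono joinedD(4)[OF j] by metis
    then show "z \<in> Collect (joined X f t x)" using j connected_component_of_trans by fastforce
  qed
  moreover have "Collect (joined X f t x) \<in> connected_components_of (subtopology X (sublevel X f t))"
    using joinedD(1,3)[OF j] by (auto simp: connected_components_of_def sublevel_def)
  ultimately show "\<exists>C\<in>connected_components_of (subtopology X (sublevel X f t)). M \<subseteq> C \<and> N \<subseteq> C"
    by blast
qed

lemma merge_level_eq_Inf:
  assumes "M \<in> local_minima X f" "N \<in> local_minima X f" "x \<in> M" "y \<in> N"
  shows "merge_level X f M N = Inf {t. joined X f t x y}"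
  unfolding merge_level_def merge_level_iff_components[OF assms] ..

text \<open>Closedness shows that the infimum defining the merge level is attained.\<close>

lemma joined_iff_merge_level:
  assumes "compact_space X" "Hausdorff_space X" "continuous_map X euclideanreal f"
    and conn: "connected_space X"
    and MN: "M \<in> local_minima X f" "N \<in> local_minima X f" "x \<in> M" "y \<in> N"
  shows "joined X f t x y \<longleftrightarrow> merge_level X f M N \<le> t"
proof -
  let ?A = "{t. joined X f t x y}"
  note x = local_minimum_at[OF MN(1,3)] and y = local_minimum_at[OF MN(2,4)]
  have "continuous_map euclideanreal (prod_topology X euclideanreal) (\<lambda>t. (y, t))"
    using y(1) by (auto intro!: continuous_map_pairedI)
  from closedin_continuous_map_preimage[OF this closedin_joined[OF assms(1-3), of x]]
  have cl: "closed ?A" by simp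
  have "compactin X (topspace X)" using assms(1) by (simp add: compact_space_def)
  then have "compact (f ` topspace X)" using assms(3) image_compactin by fastforce
  then obtain s where s: "\<And>v. v \<in> f ` topspace X \<Longrightarrow> v \<le> s"
    using compact_attains_sup[of "f ` topspace X"] x(1) by blast
  have "joined X f s x y"
    using conn x(1) y(1) s by (intro joined_connectedin[of X "topspace X"])
      (auto simp: sublevel_def connectedin_topspace)
  then have ne: "?A \<noteq> {}" by blast
  have bb: "bdd_below ?A" by (rule bdd_belowI[of _ "f x"]) (simp add: joinedD(3))
  have "Inf ?A \<in> ?A" using closed_contains_Inf[OF ne bb cl] .
  then have "joined X f t x y \<longleftrightarrow> Inf ?A \<le> t"
    using joined_mono[of X f "Inf ?A" x y t] cInf_lower[OF _ bb] by auto
  then show ?thesis by (simp add: merge_level_eq_Inf[OF MN])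
qed

text \<open>If there are finitely many local minima, the branches above them form a branch system.\<close>

lemma merge_tree_branch_system:
  assumes X: "compact_space X" "Hausdorff_space X" "continuous_map X euclideanreal f"
    and "finite I" and M: "M ` I = local_minima X f" and x: "\<And>i. i \<in> I \<Longrightarrow> x i \<in> M i"
    and c: "\<And>i. i \<in> I \<Longrightarrow> common_value f (M i) = c i"
  shows "branch_system (merge_tree X f) merge_tree_gauge I c
    (\<lambda>i t. merge_rel X f `` {(x i, t)})"
proof -
  have xi: "x i \<in> topspace X" "c i = f (x i)" if "i \<in> I" for i
  proof -
    have "M i \<in> local_minima X f" using that M by blast
    from local_minimum_at[OF this x[OF that]] c[OF that]
    show "x i \<in> topspace X" "c i = f (x i)" by simp_all
  qed
  have ep: "(x i, t) \<in> epigraph_of X f" if "i \<in> I" "f (x i) \<le> t" for i t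
    using xi that by (simp add: epigraph_of_def)
  show ?thesis
    unfolding branch_system_def
  proof (intro conjI ballI allI impI)
    fix i assume i: "i \<in> I"
    show "continuous_map (top_of_set {c i..}) (merge_tree X f)
        (\<lambda>t. merge_rel X f `` {(x i, t)})"
      using continuous_map_branch[OF xi(1)[OF i]] xi(2)[OF i] by metis
    show "closedin (merge_tree X f) ((\<lambda>t. merge_rel X f `` {(x i, t)}) ` {c i..})"
      using closedin_branch[OF X xi(1)[OF i]] xi(2)[OF i] by metis
    fix t assume "c i \<le> t"
    then show "merge_tree_gauge (merge_rel X f `` {(x i, t)}) = t"
      using merge_tree_gauge_class ep xi(2)[OF i] i by metis
  next
    show "topspace (merge_tree X f) = (\<Union>i\<in>I. (\<lambda>t. merge_rel X f `` {(x i, t)}) ` {c i..})"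
      (is "_ = ?U")
    proof
      show "topspace (merge_tree X f) \<subseteq> ?U"
      proof
        fix z assume "z \<in> topspace (merge_tree X f)"
        then obtain y t where yt: "(y, t) \<in> epigraph_of X f" "z = merge_rel X f `` {(y, t)}"
          using merge_tree_pointE by metis
        then have "y \<in> topspace X" "f y \<le> t" by (auto simp: epigraph_of_def)
        then obtain N where N: "N \<in> local_minima X f" "\<forall>v\<in>N. joined X f t v y"
          using local_minimum_below[OF X(1,3)] by blast
        then obtain i where i: "i \<in> I" "N = M i" using M by blast
        then have j: "joined X f t (x i) y" using N x by blast
        then have t: "f (x i) \<le> t" using joinedD(3) by metis
        then have "z = merge_rel X f `` {(x i, t)}"
          using merge_class_eq[OF ep[OF i(1) t] yt(1)] j yt(2) by simp
        then show "z \<in> ?U" using i t xi(2) by auto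
      qed
      show "?U \<subseteq> topspace (merge_tree X f)" using merge_class_in[OF ep] xi(2) by auto
    qed
  next
    fix i j s t
    assume ij: "i \<in> I" "j \<in> I" and *: "c i \<le> s \<and> c j \<le> s \<and> s \<le> t
      \<and> merge_rel X f `` {(x i, s)} = merge_rel X f `` {(x j, s)}"
    then have le: "f (x i) \<le> s" "f (x j) \<le> s" "s \<le> t" "f (x i) \<le> t" "f (x j) \<le> t"
      using xi(2) by auto
    have "joined X f s (x i) (x j)"
      using * merge_class_eq[OF ep[OF ij(1) le(1)] ep[OF ij(2) le(2)]] by simp
    then have "joined X f t (x i) (x j)" using le(3) by (rule joined_mono)
    then show "merge_rel X f `` {(x i, t)} = merge_rel X f `` {(x j, t)}"
      using merge_class_eq[OF ep[OF ij(1) le(4)] ep[OF ij(2) le(5)]] by simp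
  qed (use assms(4) continuous_map_gauge in auto)
qed

text \<open>Conversely, a branch system of the merge tree determines the local minima, provided that no
  branch starts on another one: the starting points of the branches are the classes of the local
  minima at their own values.\<close>

lemma local_minima_of_branch_system:
  assumes X: "compact_space X" "Hausdorff_space X" "continuous_map X euclideanreal f"
    and conn: "connected_space X"
    and bs: "branch_system (merge_tree X f) merge_tree_gauge I c \<gamma>"
    and irr: "\<And>i j. i \<in> I \<Longrightarrow> j \<in> I \<Longrightarrow> c j \<le> c i \<Longrightarrow> \<gamma> i (c i) = \<gamma> j (c i) \<Longrightarrow> i = j"
  shows "\<exists>M. bij_betw M I (local_minima X f) \<and> (\<forall>i\<in>I. common_value f (M i) = c i) \<and>
    (\<forall>i\<in>I. \<forall>j\<in>I. \<forall>t. merge_level X f (M i) (M j) \<le> t \<longleftrightarrow> c i \<le> t \<and> c j \<le> t \<and> \<gamma> i t = \<gamma> j t)"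
proof -
  let ?cl = "\<lambda>x t. merge_rel X f `` {(x, t)}"
  note b = branch_systemD[OF bs]
  have ep: "(x, t) \<in> epigraph_of X f" if "x \<in> topspace X" "f x \<le> t" for x t
    using that by (simp add: epigraph_of_def)
  have follow: "?cl x t = \<gamma> i t"
    if "x \<in> topspace X" "f x \<le> a" "i \<in> I" "c i \<le> a" "?cl x a = \<gamma> i a" "a \<le> t" for x i a t
  proof (rule section_follows_branch[OF bs])
    show "continuous_map (top_of_set {a..}) (merge_tree X f) (?cl x)"
      using continuous_map_branch[OF that(1), of f] that(2)
      by (metis atLeast_subset_iff continuous_map_from_subtopology_mono)
    fix u assume "a \<le> u"
    then have "f x \<le> u" using that(2) by simp
    then show "merge_tree_gauge (?cl x u) = u" by (rule merge_tree_gauge_class[OF ep[OF that(1)]])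
  qed (use that in auto)
  have "\<exists>x. x \<in> topspace X \<and> f x \<le> c i \<and> ?cl x (c i) = \<gamma> i (c i)" if i: "i \<in> I" for i
  proof -
    obtain x t where xt: "(x, t) \<in> epigraph_of X f" "\<gamma> i (c i) = ?cl x t"
      "merge_tree_gauge (\<gamma> i (c i)) = t"
      using merge_tree_pointE[OF b(8)[OF i order_refl]] by metis
    then have "t = c i" using b(5)[OF i order_refl] by simp
    then show ?thesis using xt by (auto simp: epigraph_of_def)
  qed
  then obtain x where x: "\<And>i. i \<in> I \<Longrightarrow> x i \<in> topspace X" "\<And>i. i \<in> I \<Longrightarrow> f (x i) \<le> c i"
    and xcl: "\<And>i. i \<in> I \<Longrightarrow> ?cl (x i) (c i) = \<gamma> i (c i)" by metis
  have on: "\<exists>j. j \<in> I \<and> c j \<le> t \<and> ?cl y t = \<gamma> j t" if "y \<in> topspace X" "f y \<le> t" for y t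
    using branch_systemE[OF bs merge_class_in[OF ep[OF that]]] merge_tree_gauge_class[OF ep[OF that]]
    by metis
  \<comment> \<open>A point of the class at which \<open>f\<close> is smaller would lie on another branch, joining branch
    \<open>i\<close> no later than at its start.\<close>
  have const: "f y = c i" if i: "i \<in> I" and y: "joined X f (c i) (x i) y" for i y
  proof -
    have yX: "y \<in> topspace X" "f y \<le> c i" using joinedD[OF y] by auto
    obtain j where j: "j \<in> I" "c j \<le> f y" "?cl y (f y) = \<gamma> j (f y)"
      using on[OF yX(1) order_refl] by blast
    have "?cl y (c i) = \<gamma> j (c i)" using follow[OF yX(1) order_refl j yX(2)] .
    moreover have "?cl y (c i) = \<gamma> i (c i)"
      using merge_class_eq[OF ep[OF x(1)[OF i] x(2)[OF i]] ep[OF yX]] y xcl[OF i] by simp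
    ultimately have "i = j" using irr[OF i j(1)] j(2) yX(2) by auto
    then show ?thesis using j(2) yX(2) by simp
  qed
  have fx: "f (x i) = c i" if "i \<in> I" for i
    using const[OF that joined_refl[of "x i" X f "c i"]] x that by simp
  define M where "M i = Collect (joined X f (c i) (x i))" for i
  have M: "M i \<in> local_minima X f" "x i \<in> M i" if "i \<in> I" for i
  proof -
    show "M i \<in> local_minima X f"
      unfolding local_minima_iff using x(1)[OF that] fx[OF that] const[OF that]
      by (intro bexI[of _ "x i"]) (auto simp: M_def)
    show "x i \<in> M i" using x[OF that] by (simp add: M_def joined_refl)
  qed
  have cv: "common_value f (M i) = c i" if "i \<in> I" for i
    using local_minimum_at(2)[OF M[OF that]] fx[OF that] by simp
  have lev: "merge_level X f (M i) (M j) \<le> t \<longleftrightarrow> c i \<le> t \<and> c j \<le> t \<and> \<gamma> i t = \<gamma> j t"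
    if ij: "i \<in> I" "j \<in> I" for i j t
  proof -
    have "joined X f t (x i) (x j) \<longleftrightarrow> c i \<le> t \<and> c j \<le> t \<and> joined X f t (x i) (x j)"
      using joinedD(3,4) fx ij by metis
    also have "\<dots> \<longleftrightarrow> c i \<le> t \<and> c j \<le> t \<and> ?cl (x i) t = ?cl (x j) t"
      using merge_class_eq[OF ep[OF x(1)[OF ij(1)], of t] ep[OF x(1)[OF ij(2)], of t]] fx ij
      by (intro conj_cong refl) simp_all
    also have "\<dots> \<longleftrightarrow> c i \<le> t \<and> c j \<le> t \<and> \<gamma> i t = \<gamma> j t"
      using follow[OF x(1)[OF ij(1)] _ ij(1) order_refl xcl[OF ij(1)], of t]
        follow[OF x(1)[OF ij(2)] _ ij(2) order_refl xcl[OF ij(2)], of t] fx ij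
      by (intro conj_cong refl) simp_all
    finally show ?thesis
      using joined_iff_merge_level[OF X conn M(1)[OF ij(1)] M(1)[OF ij(2)] M(2)[OF ij(1)] M(2)[OF ij(2)]]
      by simp
  qed
  have "inj_on M I"
  proof (rule inj_onI)
    fix i j assume ij: "i \<in> I" "j \<in> I" "M i = M j"
    have "c i = c j" using cv ij by metis
    moreover have "merge_level X f (M i) (M j) \<le> c i" using lev[of i i "c i"] ij by simp
    ultimately show "i = j" using lev[of i j "c i"] irr[of i j] ij by simp
  qed
  moreover have "M ` I = local_minima X f"
  proof
    show "local_minima X f \<subseteq> M ` I"
    proof
      fix N assume N: "N \<in> local_minima X f"
      then obtain y where y: "y \<in> N" using local_minimum_nonempty by blast
      note ly = local_minimum_at[OF N y]
      obtain j where j: "j \<in> I" "c j \<le> f y" "?cl y (f y) = \<gamma> j (f y)"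
        using on[OF ly(1) order_refl] by blast
      have "?cl (x j) (f y) = \<gamma> j (f y)"
        using follow[OF x(1)[OF j(1)] _ j(1) order_refl xcl[OF j(1)] j(2)] x(2) j by simp
      then have jy: "joined X f (f y) y (x j)"
        using merge_class_eq[OF ep[OF ly(1) order_refl] ep[OF x(1)[OF j(1)]], of "f y"] j fx[OF j(1)] by simp
      then have "x j \<in> N" using ly(3) by auto
      then have "N = Collect (joined X f (f (x j)) (x j))" using local_minimum_at(3)[OF N] by blast
      then have "N = M j" using fx[OF j(1)] by (simp add: M_def)
      then show "N \<in> M ` I" using j(1) by blast
    qed
  qed (use M in blast)
  ultimately show ?thesis using cv lev by (intro exI[of _ M]) (simp add: bij_betw_def)
qed

section \<open>The branches of a cellular merge tree\<close>

lemma topspace_geometric_realization: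
  "topspace (geometric_realization V E) =
     {a \<in> extensional V. (\<forall>v\<in>V. 0 \<le> a v) \<and> sum a V = 1 \<and> {v \<in> V. a v \<noteq> 0} \<in> (\<lambda>v. {v}) ` V \<union> E}"
  by (auto simp: geometric_realization_def PiE_def)

lemma edge_point_apply:
  assumes "w \<in> V"
  shows "edge_point V u v s w = (1 - s) * (if w = u then 1 else 0) + s * (if w = v then 1 else 0)"
  using assms by (simp add: edge_point_def)

lemma edge_point_0: "edge_point V u v 0 = vertex_point V u"
  by (auto simp: edge_point_def vertex_point_def)

lemma edge_point_1: "edge_point V u v 1 = vertex_point V v"
  by (auto simp: edge_point_def vertex_point_def)

lemma edge_point_swap: "edge_point V u v s = edge_point V v u (1 - s)"
  by (auto simp: edge_point_def)

lemma edge_point_support: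
  assumes "u \<in> V" "v \<in> V" "u \<noteq> v" "0 < s" "s < 1"
  shows "{w \<in> V. edge_point V u v s w \<noteq> 0} = {u, v}"
  using assms by (auto simp: edge_point_apply split: if_splits)

lemma edge_point_in_realization:
  assumes "finite V" "{u, v} \<in> E" "u \<in> V" "v \<in> V" "u \<noteq> v" "0 \<le> s" "s \<le> 1"
  shows "edge_point V u v s \<in> topspace (geometric_realization V E)"
proof (cases "s = 0 \<or> s = 1")
  case True
  then show ?thesis using assms vertex_point_in_realization
    by (auto simp: edge_point_0 edge_point_1)
next
  case False
  then have supp: "{w \<in> V. edge_point V u v s w \<noteq> 0} = {u, v}"
    using edge_point_support[of u V v s] assms by (simp add: less_le)
  have "sum (edge_point V u v s) V
      = (\<Sum>w\<in>V. (1 - s) * (if w = u then 1 else 0) + s * (if w = v then 1 else 0))"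
    by (intro sum.cong) (simp_all add: edge_point_apply)
  also have "\<dots> = 1"
    using assms by (simp add: sum.distrib flip: sum_distrib_left)
  finally have "sum (edge_point V u v s) V = 1" .
  moreover have "\<forall>w\<in>V. 0 \<le> edge_point V u v s w" using assms by (simp add: edge_point_apply)
  moreover have "edge_point V u v s \<in> extensional V" by (simp add: edge_point_def)
  ultimately show ?thesis using assms(2) supp by (simp add: topspace_geometric_realization)
qed

text \<open>A point of the realization is a vertex or lies in the interior of an edge.\<close>

lemma realization_point_cases:
  assumes "finite V" and a: "a \<in> topspace (geometric_realization V E)"
    and E: "\<And>e. e \<in> E \<Longrightarrow> \<exists>u v. e = {u, v} \<and> u \<in> V \<and> v \<in> V \<and> u \<noteq> v"
  shows "(\<exists>v\<in>V. a = vertex_point V v) \<or>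
    (\<exists>u v s. {u, v} \<in> E \<and> 0 < s \<and> s < 1 \<and> a = edge_point V u v s)"
proof -
  have a: "a \<in> extensional V" "\<And>v. v \<in> V \<Longrightarrow> 0 \<le> a v" "sum a V = 1"
    "{v \<in> V. a v \<noteq> 0} \<in> (\<lambda>v. {v}) ` V \<union> E"
    using a by (auto simp: topspace_geometric_realization)
  have sum: "sum a {v \<in> V. a v \<noteq> 0} = 1"
    using a(3) \<open>finite V\<close> by (simp add: sum.setdiff_irrelevant[of V a, symmetric] set_diff_eq)
  show ?thesis
  proof (cases "{v \<in> V. a v \<noteq> 0} \<in> E")
    case False
    then obtain v where v: "v \<in> V" "{v \<in> V. a v \<noteq> 0} = {v}" using a(4) by auto
    then have "a v = 1" using sum by simp
    moreover have "a w = 0" if "w \<in> V" "w \<noteq> v" for w using v that by blast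
    ultimately have "a = vertex_point V v"
      using a(1) v(1) by (intro extensionalityI[of _ V]) (auto simp: vertex_point_def)
    then show ?thesis using v(1) by blast
  next
    case True
    then obtain u v where uv: "{v \<in> V. a v \<noteq> 0} = {u, v}" "u \<in> V" "v \<in> V" "u \<noteq> v"
      using E by metis
    then have 1: "a u + a v = 1" using sum by simp
    have "a u \<noteq> 0" "a v \<noteq> 0" using uv(1) by blast+
    then have pos: "0 < a u" "0 < a v" using a(2) uv by (simp_all add: less_le)
    have "a w = 0" if "w \<in> V" "w \<noteq> u" "w \<noteq> v" for w using uv(1) that by blast
    then have "a = edge_point V u v (a v)"
      using a(1) uv 1 by (intro extensionalityI[of _ V]) (auto simp: edge_point_def)
    moreover have "{u, v} \<in> E" using True uv(1) by simp
    ultimately show ?thesis using pos 1 by (metis less_add_same_cancel2)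
  qed
qed

lemma continuous_map_edge_point:
  assumes "finite V" "{u, v} \<in> E" "u \<in> V" "v \<in> V" "u \<noteq> v"
  shows "continuous_map (top_of_set {0..1}) (geometric_realization V E) (edge_point V u v)"
proof -
  have "continuous_map (top_of_set {0..1}) (powertop_real V) (edge_point V u v)"
    unfolding continuous_map_componentwise
  proof (intro conjI ballI)
    show "edge_point V u v ` topspace (top_of_set {0..1}) \<subseteq> extensional V"
      by (auto simp: edge_point_def)
    fix w assume w: "w \<in> V"
    have "continuous_on {0..1} (\<lambda>s. (1 - s) * (if w = u then 1 else 0) + s * (if w = v then 1 else (0::real)))"
      by (intro continuous_intros)
    then show "continuous_map (top_of_set {0..1}) euclideanreal (\<lambda>s. edge_point V u v s w)"
      using w by (simp add: edge_point_apply)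
  qed
  moreover have "edge_point V u v s \<in> topspace (geometric_realization V E)" if "s \<in> {0..1}" for s
    using edge_point_in_realization[OF assms] that by auto
  ultimately show ?thesis
    unfolding geometric_realization_def
    by (auto simp: continuous_map_in_subtopology Pi_iff)
qed

lemma Hausdorff_geometric_realization: "Hausdorff_space (geometric_realization V E)"
  unfolding geometric_realization_def
  by (intro Hausdorff_space_subtopology) (simp add: Hausdorff_space_product_topology)

lemma closedin_disjoint_union_topology:
  "closedin (disjoint_union_topology X Y) B \<longleftrightarrow>
    B \<subseteq> topspace X <+> topspace Y \<and> closedin X (Inl -` B) \<and> closedin Y (Inr -` B)"
proof -
  have "Inl -` (topspace X <+> topspace Y - B) = topspace X - Inl -` B"
    "Inr -` (topspace X <+> topspace Y - B) = topspace Y - Inr -` B" by auto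
  then show ?thesis
    by (auto simp: closedin_def openin_disjoint_union_topology)
qed

lemma glue_class_Inl:
  "glue_rel V E r `` {Inl a} =
    (if a \<in> topspace (geometric_realization V E) then {Inl a} else {}) \<union>
    (if a = vertex_point V r then {Inr 0} else {})"
  by (auto simp: glue_rel_def topspace_pre_cellular)

lemma glue_class_Inr:
  "glue_rel V E r `` {Inr s} =
    (if s \<in> {0..<1} then {Inr s} else {}) \<union>
    (if s = 0 then {Inl (vertex_point V r)} else {})"
  by (auto simp: glue_rel_def topspace_pre_cellular)

lemma tree_pt_eq_iff:
  assumes "a \<in> topspace (geometric_realization V E)" "b \<in> topspace (geometric_realization V E)"
  shows "tree_pt V E r a = tree_pt V E r b \<longleftrightarrow> a = b"
  using assms by (auto simp: tree_pt_def glue_class_Inl split: if_splits)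

lemma tree_pt_eq_ray_pt_iff:
  assumes "a \<in> topspace (geometric_realization V E)" "s \<in> {0..<1}"
  shows "tree_pt V E r a = ray_pt V E r s \<longleftrightarrow> a = vertex_point V r \<and> s = 0"
proof
  assume *: "tree_pt V E r a = ray_pt V E r s"
  have "Inl a \<in> tree_pt V E r a" using assms by (simp add: tree_pt_def glue_class_Inl)
  then show "a = vertex_point V r \<and> s = 0"
    unfolding * by (auto simp: ray_pt_def glue_class_Inr split: if_splits)
qed (use assms in \<open>auto simp: tree_pt_def ray_pt_def glue_class_Inl glue_class_Inr\<close>)

lemma topspace_cellular_space:
  "topspace (cellular_space V E r) =
    tree_pt V E r ` topspace (geometric_realization V E) \<union> ray_pt V E r ` {0..<1}"
  by (auto simp: cellular_space_def topspace_pre_cellular quotient_def tree_pt_def ray_pt_def)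

text \<open>Closedness in the glued space is tested on the tree and on the ray separately.\<close>

lemma closedin_cellular_space:
  "closedin (cellular_space V E r) B \<longleftrightarrow> B \<subseteq> topspace (cellular_space V E r) \<and>
    closedin (geometric_realization V E) {a \<in> topspace (geometric_realization V E). tree_pt V E r a \<in> B} \<and>
    closedin (top_of_set {0..<1}) {s \<in> {0..<1}. ray_pt V E r s \<in> B}"
proof -
  let ?R = "glue_rel V E r" and ?P = "pre_cellular V E"
  have qm: "quotient_map ?P (cellular_space V E r) (\<lambda>x. ?R `` {x})"
    unfolding cellular_space_def by (rule quotient_map_quotient_topology)
  let ?S = "{x \<in> topspace ?P. ?R `` {x} \<in> B}"
  have "Inl -` ?S = {a \<in> topspace (geometric_realization V E). tree_pt V E r a \<in> B}"
    "Inr -` ?S = {s \<in> {0..<1}. ray_pt V E r s \<in> B}"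
    by (auto simp: topspace_pre_cellular tree_pt_def ray_pt_def)
  moreover have "?S \<subseteq> topspace (geometric_realization V E) <+> {0..<1}"
    by (auto simp: topspace_pre_cellular)
  ultimately have "closedin ?P ?S \<longleftrightarrow>
    closedin (geometric_realization V E) {a \<in> topspace (geometric_realization V E). tree_pt V E r a \<in> B} \<and>
    closedin (top_of_set {0..<1}) {s \<in> {0..<1}. ray_pt V E r s \<in> B}"
    unfolding pre_cellular_def closedin_disjoint_union_topology
    by (simp add: pre_cellular_def)
  moreover have "closedin (cellular_space V E r) B \<longleftrightarrow> B \<subseteq> topspace (cellular_space V E r) \<and> closedin ?P ?S"
    using qm closedin_subset[of "cellular_space V E r" B] unfolding quotient_map_closedin by auto
  ultimately show ?thesis by simp
qed

lemma continuous_map_tree_pt: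
  "continuous_map (geometric_realization V E) (cellular_space V E r) (tree_pt V E r)"
  unfolding continuous_map_closedin
  by (auto simp: closedin_cellular_space topspace_cellular_space)

lemma continuous_map_ray_pt:
  "continuous_map (top_of_set {0..<1}) (cellular_space V E r) (ray_pt V E r)"
  unfolding continuous_map_closedin
  by (auto simp: closedin_cellular_space topspace_cellular_space)

text \<open>A strictly monotone continuous function on an interval has a continuous inverse; this
  turns the edges and the ray into sections of the gauge.\<close>

lemma continuous_inverse_on_interval:
  fixes g :: "real \<Rightarrow> real"
  assumes "continuous_on S g" "inj_on g S" "is_interval S"
  obtains h where "continuous_on (g ` S) h" "\<And>s. s \<in> S \<Longrightarrow> h (g s) = s" "\<And>t. t \<in> g ` S \<Longrightarrow> h t \<in> S \<and> g (h t) = t"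
proof -
  have "path_connected S" using assms(3) by (simp add: is_interval_path_connected)
  then obtain h where "homeomorphism S (g ` S) g h"
    using injective_into_1d_eq_homeomorphism[OF assms(1)] assms(2) by blast
  then show ?thesis using that[of h] unfolding homeomorphism_def by blast
qed

text \<open>The rest of this section works in a fixed cellular merge tree.\<close>

locale cellular =
  fixes V :: "'v set" and E r p
  assumes cmt: "cellular_merge_tree V E r p"
begin

abbreviation "T \<equiv> cellular_space V E r"
abbreviation "G \<equiv> geometric_realization V E"
abbreviation "A \<equiv> tree_arcs V E r"
abbreviation "vp \<equiv> vertex_pt V E r"
abbreviation "ep u v s \<equiv> tree_pt V E r (edge_point V u v s)"
abbreviation "rp \<equiv> ray_pt V E r"

lemma tree: "rooted_tree V E r"
  and cont_p: "continuous_map T euclideanreal p"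
  and antimono: "(u, v) \<in> A \<Longrightarrow> strict_antimono_on {0..1} (\<lambda>s. p (ep u v s))"
  and mono_ray: "strict_mono_on {0..<1} (\<lambda>s. p (rp s))"
  and ray_infinity: "filterlim (\<lambda>s. p (rp s)) at_top (at_left 1)"
  using cmt by (auto simp: cellular_merge_tree_def gauged_space_def)

lemma finite_V: "finite V" and root_V: "r \<in> V"
  using rooted_tree_facts[OF tree] by auto

lemma arc_edge_point_in:
  assumes "(u, v) \<in> A" "0 \<le> s" "s \<le> 1"
  shows "edge_point V u v s \<in> topspace G"
  using edge_point_in_realization[OF finite_V] tree_arcs_edge[OF assms(1)] assms(2,3) by blast

lemma ep_0: "ep u v 0 = vp u" and ep_1: "ep u v 1 = vp v"
  by (simp_all add: edge_point_0 edge_point_1 vertex_pt_def)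

lemma rp_0: "rp 0 = vp r"
proof -
  have "tree_pt V E r (vertex_point V r) = ray_pt V E r 0"
    using tree_pt_eq_ray_pt_iff[of "vertex_point V r" V E 0 r]
      vertex_point_in_realization[OF finite_V root_V] by auto
  then show ?thesis by (simp add: vertex_pt_def)
qed

lemma continuous_map_ep:
  assumes "(u, v) \<in> A"
  shows "continuous_map (top_of_set {0..1}) T (ep u v)"
proof -
  have "continuous_map (top_of_set {0..1}) G (edge_point V u v)"
    using continuous_map_edge_point[OF finite_V] tree_arcs_edge[OF assms] by blast
  then have "continuous_map (top_of_set {0..1}) T (tree_pt V E r \<circ> edge_point V u v)"
    using continuous_map_tree_pt by (rule continuous_map_compose)
  then show ?thesis by (simp add: comp_def)
qed

lemma gauge_arc_less:
  assumes "(u, v) \<in> A" "0 \<le> s" "s < t" "t \<le> 1"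
  shows "p (ep u v t) < p (ep u v s)"
  using monotone_onD[OF antimono[OF assms(1)], of s t] assms by auto

lemma gauge_vertex_less: "(u, v) \<in> A \<Longrightarrow> p (vp v) < p (vp u)"
  using gauge_arc_less[of u v 0 1] by (simp add: ep_0 ep_1)

lemma closedin_arc:
  assumes "(u, v) \<in> A"
  shows "closedin T (ep u v ` {0..1})"
  unfolding closedin_cellular_space
proof (intro conjI)
  have ein: "edge_point V u v s \<in> topspace G" if "s \<in> {0..1}" for s
    using arc_edge_point_in[OF assms] that by simp
  show "ep u v ` {0..1} \<subseteq> topspace T" using ein by (auto simp: topspace_cellular_space)
  have "{a \<in> topspace G. tree_pt V E r a \<in> ep u v ` {0..1}} = edge_point V u v ` {0..1}"
    using ein tree_pt_eq_iff[of _ V E] by (auto; blast)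
  moreover have "compactin G (edge_point V u v ` {0..1})"
  proof (rule image_compactin)
    show "compactin (top_of_set {0..1}) {0..1::real}" by (simp add: compactin_subtopology)
    show "continuous_map (top_of_set {0..1}) G (edge_point V u v)"
      using continuous_map_edge_point[OF finite_V] tree_arcs_edge[OF assms] by blast
  qed
  ultimately show "closedin G {a \<in> topspace G. tree_pt V E r a \<in> ep u v ` {0..1}}"
    using compactin_imp_closedin[OF Hausdorff_geometric_realization] by metis
  have "{s \<in> {0..<1}. rp s \<in> ep u v ` {0..1}} \<subseteq> {0}"
    using ein tree_pt_eq_ray_pt_iff[of _ V E] by (smt (verit) imageE mem_Collect_eq singletonI subsetI)
  then have "{s \<in> {0..<1}. rp s \<in> ep u v ` {0..1}} = {} \<or> {s \<in> {0..<1}. rp s \<in> ep u v ` {0..1}} = {0}"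
    by (simp only: subset_singleton_iff)
  moreover have "closedin (top_of_set {0..<1::real}) {0}"
    by (intro closed_subset) auto
  ultimately show "closedin (top_of_set {0..<1}) {s \<in> {0..<1}. rp s \<in> ep u v ` {0..1}}"
    by (elim disjE) (simp_all only: closedin_empty)
qed

lemma closedin_ray: "closedin T (rp ` {0..<1})"
  unfolding closedin_cellular_space
proof (intro conjI)
  show "rp ` {0..<1} \<subseteq> topspace T" by (auto simp: topspace_cellular_space)
  have vr: "vertex_point V r \<in> topspace G" using vertex_point_in_realization finite_V root_V by metis
  have "tree_pt V E r a \<in> rp ` {0..<1} \<longleftrightarrow> a = vertex_point V r" if "a \<in> topspace G" for a
  proof -
    have "tree_pt V E r a \<in> rp ` {0..<1} \<longleftrightarrow> (\<exists>s\<in>{0..<1::real}. a = vertex_point V r \<and> s = 0)"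
      unfolding image_iff by (intro bex_cong refl tree_pt_eq_ray_pt_iff[OF that]) 
    then show ?thesis by auto
  qed
  then have "{a \<in> topspace G. tree_pt V E r a \<in> rp ` {0..<1}} = {vertex_point V r}"
    using vr by auto
  then show "closedin G {a \<in> topspace G. tree_pt V E r a \<in> rp ` {0..<1}}"
    using vr Hausdorff_geometric_realization by (metis Hausdorff_imp_t1_space t1_space_closedin_singleton)
  have "{s \<in> {0..<1}. rp s \<in> rp ` {0..<1}} = topspace (top_of_set {0..<1})" by auto
  then show "closedin (top_of_set {0..<1}) {s \<in> {0..<1}. rp s \<in> rp ` {0..<1}}"
    by (metis closedin_topspace)
qed

text \<open>The cell of \<open>v\<close> is the arc into \<open>v\<close> without its starting point, and the ray if \<open>v\<close> is
  the root.  Leaving out the starting points makes the cells a partition of the space.\<close>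

definition cell :: "'v \<Rightarrow> (('v \<Rightarrow> real) + real) set set" where
  "cell v = (if v = r then rp ` {0..<1} else {ep u v s | u s. (u, v) \<in> A \<and> 0 < s \<and> s \<le> 1})"

lemma cell_root: "cell r = rp ` {0..<1}"
  by (simp add: cell_def)

lemma cell_arc:
  assumes "(u, v) \<in> A"
  shows "cell v = ep u v ` {0<..1}"
proof -
  have "(u', v) \<in> A \<longleftrightarrow> u' = u" for u' using tree_arcs_unique[OF tree assms] assms by blast
  then have "cell v = {ep u v s | s. 0 < s \<and> s \<le> 1}"
    using tree_arcs_edge(4)[OF assms] by (simp add: cell_def)
  then show ?thesis by (auto simp: image_def)
qed

lemma vertex_in_cell:
  assumes "v \<in> V"
  shows "vp v \<in> cell v"
proof (cases "v = r")
  case True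
  then show ?thesis using rp_0 by (auto simp: cell_root intro: image_eqI[of _ _ 0])
next
  case False
  then obtain u where u: "(u, v) \<in> A" using tree_arcs_parent_ex[OF tree assms] by blast
  show ?thesis unfolding cell_arc[OF u] using ep_1[of u v] by (intro image_eqI[of _ _ 1]) auto
qed

lemma topspace_eq_cells: "topspace T = (\<Union>v\<in>V. cell v)"
proof
  show "(\<Union>v\<in>V. cell v) \<subseteq> topspace T"
    using arc_edge_point_in by (fastforce simp: cell_def topspace_cellular_space split: if_splits)
  have "tree_pt V E r a \<in> (\<Union>v\<in>V. cell v)" if a: "a \<in> topspace G" for a
    using realization_point_cases[OF finite_V a rooted_tree_facts(4)[OF tree], simplified]
  proof (elim disjE bexE exE conjE)
    fix v assume "v \<in> V" "a = vertex_point V v"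
    then show ?thesis using vertex_in_cell by (auto simp: vertex_pt_def)
  next
    fix u v s assume uv: "{u, v} \<in> E" and s: "0 < s" "s < 1" and a: "a = edge_point V u v s"
    have "\<exists>u v s. (u, v) \<in> A \<and> 0 < s \<and> s < 1 \<and> a = edge_point V u v s"
      using edge_is_arc[OF tree uv] a s edge_point_swap[of V u v s]
      by (metis diff_gt_0_iff_gt diff_less_eq less_add_same_cancel1)
    then obtain u v s where *: "(u, v) \<in> A" "0 < s" "s < 1" "a = edge_point V u v s" by blast
    then have "tree_pt V E r a \<in> cell v" using cell_arc[OF *(1)] by auto
    then show ?thesis using tree_arcs_edge(3)[OF *(1)] by blast
  qed
  then show "topspace T \<subseteq> (\<Union>v\<in>V. cell v)"
    using root_V cell_root by (auto simp: topspace_cellular_space)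
qed

lemma cell_disjoint:
  assumes "v \<in> V" "w \<in> V" "v \<noteq> w"
  shows "cell v \<inter> cell w = {}"
proof -
  have ray: "cell v \<inter> cell r = {}" if v: "v \<in> V" "v \<noteq> r" for v
  proof -
    obtain u where u: "(u, v) \<in> A" using tree_arcs_parent_ex[OF tree v] by blast
    have "edge_point V u v s \<noteq> vertex_point V r" if "0 < s" for s
    proof
      assume "edge_point V u v s = vertex_point V r"
      then have "edge_point V u v s v = vertex_point V r v" by simp
      then show False
        using v that tree_arcs_edge(5)[OF u] by (auto simp: edge_point_apply vertex_point_def)
    qed
    then show ?thesis
      using tree_pt_eq_ray_pt_iff[OF arc_edge_point_in[OF u]] by (auto simp: cell_arc[OF u] cell_root)
  qed
  show ?thesis
  proof (cases "v = r \<or> w = r")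
    case True
    then show ?thesis using ray assms by (metis inf_commute)
  next
    case False
    obtain u where u: "(u, v) \<in> A" using tree_arcs_parent_ex[OF tree] assms False by blast
    obtain u' where u': "(u', w) \<in> A" using tree_arcs_parent_ex[OF tree] assms False by blast
    have "edge_point V u v s \<noteq> edge_point V u' w s'" if s: "0 < s" "s \<le> 1" "0 < s'" "s' \<le> 1" for s s'
    proof
      assume eq: "edge_point V u v s = edge_point V u' w s'"
      then have "edge_point V u v s v = edge_point V u' w s' v"
        "edge_point V u v s w = edge_point V u' w s' w" by simp_all
      \<comment> \<open>Each end point would have to be the parent of the other.\<close>
      then have "v = u'" "w = u"
        using assms s tree_arcs_edge(5)[OF u] tree_arcs_edge(5)[OF u']
        by (auto simp: edge_point_apply split: if_splits)
      then show False using gauge_vertex_less[OF u] gauge_vertex_less[OF u'] by simp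
    qed
    then show ?thesis
      using tree_pt_eq_iff[OF arc_edge_point_in[OF u] arc_edge_point_in[OF u']]
      by (auto simp: cell_arc[OF u] cell_arc[OF u'])
  qed
qed

text \<open>The path from \<open>v\<close> up to infinity consists of the cells of all ancestors of \<open>v\<close>.\<close>

definition upset :: "'v \<Rightarrow> (('v \<Rightarrow> real) + real) set set" where
  "upset v = (\<Union>w\<in>{w. (w, v) \<in> A\<^sup>*}. cell w)"

lemma upset_root: "upset r = rp ` {0..<1}"
proof -
  have "w = r" if "(w, r) \<in> A\<^sup>*" for w using that tree_arcs_edge(4) by (metis rtranclE)
  then have "{w. (w, r) \<in> A\<^sup>*} = {r}" by auto
  then show ?thesis by (simp add: upset_def cell_root)
qed

lemma upset_arc:
  assumes "(u, v) \<in> A"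
  shows "upset v = upset u \<union> ep u v ` {0..1}"
proof -
  have "{w. (w, v) \<in> A\<^sup>*} = insert v {w. (w, u) \<in> A\<^sup>*}"
  proof -
    have "w = v \<or> (w, u) \<in> A\<^sup>*" if "(w, v) \<in> A\<^sup>*" for w
      using that assms tree_arcs_unique[OF tree] by (metis rtranclE)
    then show ?thesis using assms by (auto intro: rtrancl_into_rtrancl)
  qed
  then have 1: "upset v = upset u \<union> ep u v ` {0<..1}" by (auto simp: upset_def cell_arc[OF assms])
  have "vp u \<in> upset u"
    using vertex_in_cell tree_arcs_edge(2)[OF assms] by (auto simp: upset_def)
  moreover have "ep u v ` {0..1} = insert (vp u) (ep u v ` {0<..1})"
  proof -
    have "{0..1} = insert 0 {0<..1::real}" by auto
    then show ?thesis by (simp add: ep_0)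
  qed
  ultimately show ?thesis using 1 by auto
qed

lemma upset_Int:
  assumes "v \<in> V" "w \<in> V"
  shows "upset v \<inter> upset w = upset (LCA V E r v w)"
proof -
  note lca = LCA_characterization(1)[OF tree, of "\<lambda>v. p (vp v)", OF gauge_vertex_less assms]
  have same: "x = y" if "(x, v) \<in> A\<^sup>*" "(y, w) \<in> A\<^sup>*" "z \<in> cell x" "z \<in> cell y" for x y z
    using that cell_disjoint arcs_rtrancl_in_V assms by (metis disjoint_iff)
  then have "z \<in> (\<Union>x\<in>{x. (x, v) \<in> A\<^sup>* \<and> (x, w) \<in> A\<^sup>*}. cell x)" if "z \<in> upset v" "z \<in> upset w" for z
  proof -
    obtain x where x: "(x, v) \<in> A\<^sup>*" "z \<in> cell x" using \<open>z \<in> upset v\<close> by (auto simp: upset_def)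
    obtain y where y: "(y, w) \<in> A\<^sup>*" "z \<in> cell y" using \<open>z \<in> upset w\<close> by (auto simp: upset_def)
    have "x = y" using same[OF x(1) y(1) x(2) y(2)] .
    then show ?thesis using x y by auto
  qed
  then show ?thesis by (auto simp: upset_def lca)
qed

text \<open>A branch at \<open>v\<close> is a continuous section of the gauge whose image is the path from \<open>v\<close> up
  to infinity.  It is built by recursion along the arcs from the root.\<close>

definition is_branch :: "'v \<Rightarrow> (real \<Rightarrow> (('v \<Rightarrow> real) + real) set) \<Rightarrow> bool" where
  "is_branch v \<gamma> \<longleftrightarrow> continuous_map (top_of_set {p (vp v)..}) T \<gamma> \<and>
     (\<forall>t\<ge>p (vp v). p (\<gamma> t) = t) \<and> \<gamma> ` {p (vp v)..} = upset v"

lemma is_branch_at: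
  assumes "is_branch v \<gamma>" "z \<in> upset v"
  shows "p (vp v) \<le> p z" "\<gamma> (p z) = z"
  using assms unfolding is_branch_def by (metis (no_types, lifting) atLeast_iff imageE)+

lemma root_branch_ex: "\<exists>\<gamma>. is_branch r \<gamma>"
proof -
  let ?g = "\<lambda>s. p (rp s)"
  have "continuous_map (top_of_set {0..<1}) euclideanreal (p \<circ> rp)"
    using continuous_map_ray_pt cont_p by (rule continuous_map_compose)
  then have cont: "continuous_on {0..<1} ?g" by (simp add: comp_def)
  have img: "?g ` {0..<1} = {p (vp r)..}"
  proof
    show "?g ` {0..<1} \<subseteq> {p (vp r)..}"
      using strict_mono_onD[OF mono_ray, of 0] unfolding rp_0[symmetric]
      by (auto simp: le_less)
    show "{p (vp r)..} \<subseteq> ?g ` {0..<1}"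
    proof
      fix t assume t: "t \<in> {p (vp r)..}"
      have "eventually (\<lambda>s. t \<le> ?g s) (at_left 1)"
        using ray_infinity by (simp add: filterlim_at_top)
      moreover have "eventually (\<lambda>s. s \<in> {0<..<1}) (at_left (1::real))"
        by (rule eventually_at_leftI[of 0]) auto
      ultimately have "eventually (\<lambda>s. t \<le> ?g s \<and> s \<in> {0<..<1}) (at_left 1)"
        by (rule eventually_conj)
      then obtain b where b: "t \<le> ?g b" "0 < b" "b < 1"
        using eventually_happens'[OF trivial_limit_at_left_real] by auto
      have "continuous_on {0..b} ?g" using cont b by (elim continuous_on_subset) auto
      then obtain s where "0 \<le> s" "s \<le> b" "?g s = t"
        using IVT'[of ?g 0 t b] b t rp_0 by auto
      then show "t \<in> ?g ` {0..<1}" using b by auto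
    qed
  qed
  have "inj_on ?g {0..<1}" using mono_ray by (rule strict_mono_on_imp_inj_on)
  moreover have "is_interval {0..<1::real}" by (rule is_interval_co)
  ultimately obtain h where h: "continuous_on (?g ` {0..<1}) h"
    "\<And>s. s \<in> {0..<1} \<Longrightarrow> h (?g s) = s" "\<And>t. t \<in> ?g ` {0..<1} \<Longrightarrow> h t \<in> {0..<1} \<and> ?g (h t) = t"
    using continuous_inverse_on_interval[OF cont] by metis
  have "continuous_map (top_of_set {p (vp r)..}) (top_of_set {0..<1}) h"
    using h(1,3) img by (auto simp: continuous_map_in_subtopology)
  then have "continuous_map (top_of_set {p (vp r)..}) T (rp \<circ> h)"
    using continuous_map_ray_pt by (rule continuous_map_compose)
  moreover have "(rp \<circ> h) ` {p (vp r)..} = rp ` {0..<1}"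
  proof -
    have "h ` (?g ` {0..<1}) = {0..<1}" using h(2,3) by (auto simp: image_image image_iff)
    then show ?thesis unfolding img by (metis image_comp)
  qed
  moreover have "p ((rp \<circ> h) t) = t" if "t \<ge> p (vp r)" for t
    using h(3)[of t] that unfolding img by simp
  ultimately have "is_branch r (rp \<circ> h)" unfolding is_branch_def upset_root by blast
  then show ?thesis by blast
qed

lemma arc_branch_ex:
  assumes uv: "(u, v) \<in> A" and \<gamma>: "is_branch u \<gamma>"
  shows "\<exists>\<gamma>'. is_branch v \<gamma>'"
proof -
  let ?g = "\<lambda>s. p (ep u v s)"
  let ?a = "p (vp v)" and ?b = "p (vp u)"
  have ab: "?a < ?b" using gauge_vertex_less[OF uv] .
  have "continuous_map (top_of_set {0..1}) euclideanreal (p \<circ> ep u v)"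
    using continuous_map_ep[OF uv] cont_p by (rule continuous_map_compose)
  then have cont: "continuous_on {0..1} ?g" by (simp add: comp_def)
  have img: "?g ` {0..1} = {?a..?b}"
  proof
    show "?g ` {0..1} \<subseteq> {?a..?b}"
      using gauge_arc_less[OF uv, of 0] gauge_arc_less[OF uv, of _ 1]
      by (force simp: ep_0[of u v, symmetric] ep_1[of u v, symmetric] le_less)
    show "{?a..?b} \<subseteq> ?g ` {0..1}"
      using IVT2'[of ?g 1 _ 0] cont by (fastforce simp: ep_0 ep_1)
  qed
  have "inj_on ?g {0..1}"
    using gauge_arc_less[OF uv] by (intro linorder_inj_onI) fastforce+
  moreover have "is_interval {0..1::real}" by (rule is_interval_cc)
  ultimately obtain h where h: "continuous_on (?g ` {0..1}) h"
    "\<And>s. s \<in> {0..1} \<Longrightarrow> h (?g s) = s" "\<And>t. t \<in> ?g ` {0..1} \<Longrightarrow> h t \<in> {0..1} \<and> ?g (h t) = t"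
    using continuous_inverse_on_interval[OF cont] by metis
  have "continuous_map (top_of_set {?a..?b}) (top_of_set {0..1}) h"
    using h(1,3) img by (auto simp: continuous_map_in_subtopology)
  then have ch: "continuous_map (top_of_set {?a..?b}) T (ep u v \<circ> h)"
    using continuous_map_ep[OF uv] by (rule continuous_map_compose)
  have \<gamma>b: "\<gamma> ?b = ep u v (h ?b)"
  proof -
    have "vp u \<in> upset u"
      using vertex_in_cell tree_arcs_edge(2)[OF uv] by (auto simp: upset_def)
    then have "\<gamma> ?b = vp u" using is_branch_at[OF \<gamma>] by simp
    moreover have "h ?b = 0" using h(2)[of 0] by (simp add: ep_0)
    ultimately show ?thesis by (simp add: ep_0)
  qed
  let ?\<gamma>' = "\<lambda>t. if ?b \<le> t then \<gamma> t else (ep u v \<circ> h) t"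
  have "continuous_map (top_of_set {?a..}) T ?\<gamma>'"
  proof (rule continuous_map_cases_le)
    have "subtopology (top_of_set {?a..}) {x \<in> topspace (top_of_set {?a..}). ?b \<le> x} = top_of_set {?b..}"
      using ab by (auto simp: subtopology_subtopology intro!: arg_cong[where f = top_of_set])
    then show "continuous_map (subtopology (top_of_set {?a..}) {x \<in> topspace (top_of_set {?a..}). ?b \<le> x}) T \<gamma>"
      using \<gamma> by (simp add: is_branch_def)
    have "subtopology (top_of_set {?a..}) {x \<in> topspace (top_of_set {?a..}). x \<le> ?b} = top_of_set {?a..?b}"
      using ab by (auto simp: subtopology_subtopology intro!: arg_cong[where f = top_of_set])
    then show "continuous_map (subtopology (top_of_set {?a..}) {x \<in> topspace (top_of_set {?a..}). x \<le> ?b}) T (ep u v \<circ> h)"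
      using ch by simp
    show "\<gamma> t = (ep u v \<circ> h) t" if "?b = t" for t using \<gamma>b that by auto
  qed auto
  moreover have "p (?\<gamma>' t) = t" if "t \<ge> ?a" for t
    using h(3)[of t] \<gamma> that unfolding img by (simp add: is_branch_def)
  moreover have "?\<gamma>' ` {?a..} = upset v"
  proof -
    have "(ep u v \<circ> h) ` {?a..?b} = ep u v ` {0..1}"
    proof -
      have "h ` (?g ` {0..1}) = {0..1}" using h(2,3) by (auto simp: image_image image_iff)
      then show ?thesis unfolding img by (metis image_comp)
    qed
    moreover have "?\<gamma>' ` {?a..} = \<gamma> ` {?b..} \<union> (ep u v \<circ> h) ` {?a..?b}"
    proof -
      have "?\<gamma>' ` {?a..?b} = (ep u v \<circ> h) ` {?a..?b}"
        using \<gamma>b by (intro image_cong) auto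
      moreover have "?\<gamma>' ` {?b..} = \<gamma> ` {?b..}" by (intro image_cong) auto
      moreover have "{?a..} = {?b..} \<union> {?a..?b}" using ab by auto
      ultimately show ?thesis by (simp only: image_Un)
    qed
    ultimately show ?thesis
      using \<gamma> unfolding upset_arc[OF uv] is_branch_def by simp
  qed
  ultimately show ?thesis unfolding is_branch_def by blast
qed

lemma branch_ex:
  assumes "v \<in> V"
  shows "\<exists>\<gamma>. is_branch v \<gamma>"
  using root_ancestor[OF tree assms]
proof (induction rule: rtrancl_induct)
  case base
  show ?case by (rule root_branch_ex)
next
  case (step u v)
  then show ?case using arc_branch_ex by blast
qed

lemma closedin_upset:
  assumes "v \<in> V"
  shows "closedin T (upset v)"
  using root_ancestor[OF tree assms]
proof (induction rule: rtrancl_induct)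
  case base
  show ?case by (simp add: upset_root closedin_ray)
next
  case (step u v)
  then show ?case using closedin_arc by (simp add: upset_arc closedin_Un)
qed

lemma LCA_V: "v \<in> V \<Longrightarrow> w \<in> V \<Longrightarrow> LCA V E r v w \<in> V"
  using LCA_characterization(2)[OF tree, of "\<lambda>v. p (vp v)", OF gauge_vertex_less] .

text \<open>Two branches meet at the height of the lowest common ancestor.\<close>

lemma branches_meet:
  assumes v: "v \<in> V" "is_branch v \<gamma>" and w: "w \<in> V" "is_branch w \<delta>"
    and t: "p (vp v) \<le> t" "p (vp w) \<le> t"
  shows "\<gamma> t = \<delta> t \<longleftrightarrow> p (vp (LCA V E r v w)) \<le> t"
proof -
  let ?l = "LCA V E r v w"
  obtain \<beta> where \<beta>: "is_branch ?l \<beta>" using branch_ex LCA_V v w by blast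
  show ?thesis
  proof
    assume eq: "\<gamma> t = \<delta> t"
    have "\<gamma> t \<in> upset v" "\<delta> t \<in> upset w" using v w t by (auto simp: is_branch_def)
    then have "\<gamma> t \<in> upset ?l" using eq upset_Int[OF v(1) w(1)] by auto
    then have "p (vp ?l) \<le> p (\<gamma> t)" by (rule is_branch_at[OF \<beta>])
    then show "p (vp ?l) \<le> t" using v t by (simp add: is_branch_def)
  next
    assume le: "p (vp ?l) \<le> t"
    then have "\<beta> t \<in> upset ?l" "p (\<beta> t) = t" using \<beta> by (auto simp: is_branch_def)
    then have "\<beta> t \<in> upset v" "\<beta> t \<in> upset w" using upset_Int[OF v(1) w(1)] by auto
    then show "\<gamma> t = \<delta> t"
      using is_branch_at(2)[OF v(2)] is_branch_at(2)[OF w(2)] \<open>p (\<beta> t) = t\<close> by metis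
  qed
qed

lemma leaf_V: "v \<in> tree_leaves V E r \<Longrightarrow> v \<in> V"
  by (simp add: tree_leaves_eq[OF tree])

lemma upset_mono:
  assumes "(w, v) \<in> A\<^sup>*"
  shows "cell w \<subseteq> upset v"
  using assms by (auto simp: upset_def)

lemma leaf_branch_system:
  assumes "finite I" "l ` I = tree_leaves V E r"
  obtains \<gamma> where "branch_system T p I (\<lambda>i. p (vp (l i))) \<gamma>"
    "\<And>i j t. i \<in> I \<Longrightarrow> j \<in> I \<Longrightarrow> p (vp (l i)) \<le> t \<Longrightarrow> p (vp (l j)) \<le> t \<Longrightarrow>
      \<gamma> i t = \<gamma> j t \<longleftrightarrow> p (vp (LCA V E r (l i) (l j))) \<le> t"
proof -
  have lV: "l i \<in> V" if "i \<in> I" for i using assms that leaf_V by blast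
  then have "\<forall>i\<in>I. \<exists>\<beta>. is_branch (l i) \<beta>" using branch_ex by blast
  from bchoice[OF this] obtain \<gamma> where \<gamma>: "\<And>i. i \<in> I \<Longrightarrow> is_branch (l i) (\<gamma> i)" by blast
  note meet = branches_meet[OF lV \<gamma> lV \<gamma>]
  have top: "topspace T = (\<Union>i\<in>I. \<gamma> i ` {p (vp (l i))..})"
  proof -
    have "topspace T = (\<Union>i\<in>I. upset (l i))"
    proof
      show "topspace T \<subseteq> (\<Union>i\<in>I. upset (l i))"
        unfolding topspace_eq_cells
      proof
        fix z assume "z \<in> (\<Union>v\<in>V. cell v)"
        then obtain v where v: "v \<in> V" "z \<in> cell v" by blast
        obtain x where "x \<in> tree_leaves V E r" "(v, x) \<in> A\<^sup>*"
          using leaf_descendant_ex[OF tree, of "\<lambda>v. p (vp v)", OF gauge_vertex_less v(1)] by blast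
        moreover from this obtain i where "i \<in> I" "x = l i" using assms(2) by blast
        ultimately show "z \<in> (\<Union>i\<in>I. upset (l i))" using v(2) upset_mono by blast
      qed
      show "(\<Union>i\<in>I. upset (l i)) \<subseteq> topspace T" using closedin_subset[OF closedin_upset] lV by blast
    qed
    then show ?thesis using \<gamma> by (simp add: is_branch_def)
  qed
  have "branch_system T p I (\<lambda>i. p (vp (l i))) \<gamma>"
    unfolding branch_system_def
  proof (intro conjI ballI allI impI)
    fix i assume i: "i \<in> I"
    show "continuous_map (top_of_set {p (vp (l i))..}) T (\<gamma> i)"
      using \<gamma>[OF i] by (simp add: is_branch_def)
    show "closedin T (\<gamma> i ` {p (vp (l i))..})"
      using closedin_upset[OF lV[OF i]] \<gamma>[OF i] by (simp add: is_branch_def)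
    show "p (\<gamma> i t) = t" if "p (vp (l i)) \<le> t" for t
      using \<gamma>[OF i] that by (simp add: is_branch_def)
  next
    fix i j s t
    assume "i \<in> I" "j \<in> I" "p (vp (l i)) \<le> s \<and> p (vp (l j)) \<le> s \<and> s \<le> t \<and> \<gamma> i s = \<gamma> j s"
    then show "\<gamma> i t = \<gamma> j t" using meet[of i j s] meet[of i j t] by auto
  qed (fact assms(1) cont_p top)+
  then show ?thesis by (rule that) (rule meet)
qed

lemma leaf_below_LCA:
  assumes "v \<in> tree_leaves V E r" "w \<in> tree_leaves V E r" "v \<noteq> w"
  shows "p (vp v) < p (vp (LCA V E r v w))"
proof -
  let ?l = "LCA V E r v w"
  have V: "v \<in> V" "w \<in> V" using assms leaf_V by auto
  have l: "(?l, v) \<in> A\<^sup>*" "(?l, w) \<in> A\<^sup>*"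
    using LCA_characterization(1)[OF tree, of "\<lambda>v. p (vp v)", OF gauge_vertex_less V, of ?l] by auto
  have "?l \<noteq> v"
  proof
    assume "?l = v"
    then have "(v, w) \<in> A\<^sup>*" using l(2) by simp
    then show False using assms(1,3) tree_leaves_eq[OF tree] by (auto elim: converse_rtranclE)
  qed
  then show ?thesis
    using arcs_rtrancl_mono[of A "\<lambda>v. p (vp v)", OF gauge_vertex_less l(1)] by auto
qed

lemma LCA_sym: "v \<in> V \<Longrightarrow> w \<in> V \<Longrightarrow> LCA V E r v w = LCA V E r w v"
  by (simp add: LCA_def conj_commute conj_left_commute)

end

section \<open>Trees given by a parent function\<close>

text \<open>A finite vertex set with a root, in which every other vertex has a parent of larger height,
  is a rooted tree whose arcs lead from parents to children.\<close>

locale parent_tree =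
  fixes V :: "'v set" and r :: 'v and par :: "'v \<Rightarrow> 'v" and h :: "'v \<Rightarrow> real"
  assumes fin: "finite V" and root: "r \<in> V"
    and par_in: "\<And>v. v \<in> V \<Longrightarrow> v \<noteq> r \<Longrightarrow> par v \<in> V"
    and par_less: "\<And>v. v \<in> V \<Longrightarrow> v \<noteq> r \<Longrightarrow> h v < h (par v)"
begin

definition edges :: "'v set set" where
  "edges = {{v, par v} | v. v \<in> V - {r}}"

lemma edges_iff: "{u, v} \<in> edges \<longleftrightarrow> (u \<in> V - {r} \<and> v = par u) \<or> (v \<in> V - {r} \<and> u = par v)"
  unfolding edges_def by (auto simp: doubleton_eq_iff)

lemma root_path_ex:
  assumes "v \<in> V"
  shows "\<exists>q. graph_walk V edges (q @ [v]) \<and> distinct (q @ [v]) \<and> hd (q @ [v]) = r \<and> (\<forall>w\<in>set q. h v < h w)"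
  using assms
proof (induction "card {w \<in> V. h v < h w}" arbitrary: v rule: less_induct)
  case less
  show ?case
  proof (cases "v = r")
    case True
    then show ?thesis using root by (intro exI[of _ "[]"]) (simp add: graph_walk_def)
  next
    case False
    let ?u = "par v"
    have u: "?u \<in> V" "h v < h ?u" using par_in par_less less.prems False by auto
    have "{w \<in> V. h ?u < h w} \<subset> {w \<in> V. h v < h w}" using u by auto
    then have "card {w \<in> V. h ?u < h w} < card {w \<in> V. h v < h w}" using fin by (intro psubset_card_mono) auto
    from less.hyps[OF this u(1)] obtain q where
      q: "graph_walk V edges (q @ [?u])" "distinct (q @ [?u])" "hd (q @ [?u]) = r" "\<forall>w\<in>set q. h ?u < h w"
      by blast
    have "{?u, v} \<in> edges" using less.prems False by (simp add: edges_iff)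
    moreover have "\<forall>w\<in>set (q @ [?u]). h v < h w" using q(4) u(2) by auto
    ultimately show ?thesis using q less.prems
      by (intro exI[of _ "q @ [?u]"]) (auto simp: graph_walk_def successively_append_iff hd_append split: if_splits)
  qed
qed

lemma edges_acyclic: "\<nexists>c. graph_cycle V edges c"
proof
  assume "\<exists>c. graph_cycle V edges c"
  then obtain c where c: "graph_walk V edges c" "distinct c" "3 \<le> length c" "{last c, hd c} \<in> edges"
    by (auto simp: graph_cycle_def)
  \<comment> \<open>At a lowest vertex of a cycle both neighbours would have to be its parent.\<close>
  have "finite (set c)" "set c \<noteq> {}" using c by (auto simp: graph_walk_def)
  then obtain x where x: "x \<in> set c" and xmin: "\<And>y. y \<in> set c \<Longrightarrow> h x \<le> h y"
    using arg_min_if_finite[of "set c" h] by (metis arg_min_least)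
  have nb: "y = par x" if "{x, y} \<in> edges" "y \<in> set c" for y
    using that xmin[OF that(2)] par_less[of y] by (auto simp: edges_iff)
  obtain as bs where c_eq: "c = as @ x # bs" using x by (meson split_list)
  define d where "d = bs @ as"
  have d: "set d \<subseteq> set c" "distinct d" "2 \<le> length d" using c c_eq by (auto simp: d_def)
  have adj: "{x, hd bs} \<in> edges" if "bs \<noteq> []"
    using c(1) c_eq that by (auto simp: graph_walk_def successively_append_iff successively_Cons)
  have adj': "{last as, x} \<in> edges" if "as \<noteq> []"
    using c(1) c_eq that by (auto simp: graph_walk_def successively_append_iff)
  have "{x, hd d} \<in> edges"
    using adj c(4) c_eq d(3) by (cases "bs = []"; cases as) (auto simp: d_def)
  moreover have "{x, last d} \<in> edges"
    using adj' c(4) c_eq d(3) by (cases "as = []"; cases bs) (auto simp: d_def insert_commute)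
  moreover have "d \<noteq> []" using d(3) by auto
  then have "hd d \<in> set c" "last d \<in> set c" using d(1) by auto
  ultimately have "hd d = last d" using nb by metis
  moreover obtain a b e where "d = a # b # e" using d(3) by (cases d; cases "tl d") auto
  ultimately show False using d(2) by (auto split: if_splits)
qed

lemma rooted: "rooted_tree V edges r"
  unfolding rooted_tree_def graph_tree_def
proof (intro conjI)
  show "finite_graph V edges"
    unfolding finite_graph_def
  proof (intro conjI ballI fin)
    fix e assume "e \<in> edges"
    then obtain v where "e = {v, par v}" "v \<in> V" "v \<noteq> r" by (auto simp: edges_def)
    then show "\<exists>u v. e = {u, v} \<and> u \<in> V \<and> v \<in> V \<and> u \<noteq> v"
      using par_in par_less by (metis less_irrefl)
  qed
  let ?R = "{(u, v). {u, v} \<in> edges \<and> u \<in> V \<and> v \<in> V}\<^sup>*"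
  have root_conn: "(r, v) \<in> ?R" if "v \<in> V" for v
  proof -
    obtain q where "graph_walk V edges (q @ [v])" "hd (q @ [v]) = r" using root_path_ex[OF \<open>v \<in> V\<close>] by blast
    then show ?thesis using rtrancl_of_walk[of V edges "q @ [v]"] by simp
  qed
  have "\<exists>q. graph_walk V edges q \<and> hd q = u \<and> last q = v" if "u \<in> V" "v \<in> V" for u v
  proof -
    have "(u, v) \<in> ?R"
      using root_conn[OF that(1)] root_conn[OF that(2)] sym_edge_rel[of edges V] by (meson rtrancl_trans symD)
    then show ?thesis using distinct_walk_of_rtrancl[of u v edges V] that(2) by blast
  qed
  then show "graph_connected V edges" using root by (auto simp: graph_connected_def)
qed (use edges_acyclic root in auto)

lemma arcs_iff: "(u, v) \<in> tree_arcs V edges r \<longleftrightarrow> v \<in> V \<and> v \<noteq> r \<and> u = par v"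
proof -
  have arc: "(par v, v) \<in> tree_arcs V edges r" if v: "v \<in> V" "v \<noteq> r" for v
  proof -
    obtain q where q: "graph_walk V edges (q @ [par v])" "distinct (q @ [par v])" "hd (q @ [par v]) = r"
      "\<forall>w\<in>set q. h (par v) < h w" using root_path_ex[OF par_in[OF v]] by blast
    have "{par v, v} \<in> edges" using v by (simp add: edges_iff)
    moreover have "v \<notin> set (q @ [par v])" using q(4) par_less[OF v] by auto
    ultimately have "graph_walk V edges (q @ [par v, v]) \<and> distinct (q @ [par v, v]) \<and> hd (q @ [par v, v]) = r"
      using q v by (auto simp: graph_walk_def successively_append_iff hd_append split: if_splits)
    then show ?thesis by (auto simp: tree_arcs_def)
  qed
  show ?thesis
    using arc tree_arcs_edge(3,4) tree_arcs_unique[OF rooted] by metis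
qed

text \<open>The gauge that interpolates \<open>h\<close> linearly on the edges.  On the ray any increasing
  homeomorphism onto \<open>{h r..}\<close> would do.  It is defined on representatives and then on the
  classes of the gluing relation, on which it is constant.\<close>

definition lin_gauge_rep :: "('v \<Rightarrow> real) + real \<Rightarrow> real" where
  "lin_gauge_rep x = (case x of Inl a \<Rightarrow> (\<Sum>v\<in>V. a v * h v) | Inr s \<Rightarrow> h r + s / (1 - s))"

definition lin_gauge :: "(('v \<Rightarrow> real) + real) set \<Rightarrow> real" where
  "lin_gauge z = lin_gauge_rep (SOME x. x \<in> z)"

lemma linear_vertex: "v \<in> V \<Longrightarrow> (\<Sum>w\<in>V. vertex_point V v w * h w) = h v"
  using fin by (simp add: vertex_point_def if_distrib[of "\<lambda>x. x * _"] cong: if_cong)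

lemma lin_gauge_class:
  assumes "x \<in> topspace (pre_cellular V edges)"
  shows "lin_gauge (glue_rel V edges r `` {x}) = lin_gauge_rep x"
proof -
  have "x \<in> glue_rel V edges r `` {x}" using assms by (auto simp: glue_rel_def)
  then have "(x, SOME y. y \<in> glue_rel V edges r `` {x}) \<in> glue_rel V edges r"
    by (metis Image_singleton_iff someI)
  then show ?thesis
    unfolding lin_gauge_def by (auto simp: glue_rel_def lin_gauge_rep_def linear_vertex[OF root])
qed

lemma lin_gauge_tree_pt:
  "a \<in> topspace (geometric_realization V edges) \<Longrightarrow> lin_gauge (tree_pt V edges r a) = (\<Sum>v\<in>V. a v * h v)"
  using lin_gauge_class[of "Inl a"] by (simp add: tree_pt_def topspace_pre_cellular lin_gauge_rep_def InlI)

lemma lin_gauge_ray_pt: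
  "s \<in> {0..<1} \<Longrightarrow> lin_gauge (ray_pt V edges r s) = h r + s / (1 - s)"
  using lin_gauge_class[of "Inr s"] by (simp add: ray_pt_def topspace_pre_cellular lin_gauge_rep_def InrI)

lemma lin_gauge_vertex_pt: "v \<in> V \<Longrightarrow> lin_gauge (vertex_pt V edges r v) = h v"
  using lin_gauge_tree_pt[OF vertex_point_in_realization[OF fin]] linear_vertex by (simp add: vertex_pt_def)

lemma cellular: "cellular_merge_tree V edges r lin_gauge"
  unfolding cellular_merge_tree_def
proof (intro conjI)
  show "rooted_tree V edges r" by (rule rooted)
  let ?T = "cellular_space V edges r" and ?G = "geometric_realization V edges"
  show "gauged_space ?T lin_gauge"
    unfolding gauged_space_def continuous_map_closedin
  proof (intro conjI allI impI)
    fix C :: "real set" assume "closedin euclideanreal C"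
    then have C: "closed C" by simp
    have "continuous_map ?G euclideanreal (\<lambda>a. \<Sum>v\<in>V. a v * h v)"
      unfolding geometric_realization_def
      by (intro continuous_map_sum continuous_map_real_mult continuous_map_from_subtopology
          continuous_map_product_projection fin) auto
    then have "closedin ?G {a \<in> topspace ?G. (\<Sum>v\<in>V. a v * h v) \<in> C}"
      using C by (simp add: closedin_continuous_map_preimage)
    moreover have "{a \<in> topspace ?G. tree_pt V edges r a \<in> {z \<in> topspace ?T. lin_gauge z \<in> C}}
        = {a \<in> topspace ?G. (\<Sum>v\<in>V. a v * h v) \<in> C}"
      using lin_gauge_tree_pt by (auto simp: topspace_cellular_space)
    moreover have "closedin (top_of_set {0..<1}) {s \<in> {0..<1}. h r + s / (1 - s) \<in> C}"
    proof -
      have "continuous_on {0..<1} (\<lambda>s. h r + s / (1 - s))" by (intro continuous_intros) auto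
      from continuous_closedin_preimage[OF this C] show ?thesis by (simp add: vimage_def Int_def)
    qed
    moreover have "{s \<in> {0..<1}. ray_pt V edges r s \<in> {z \<in> topspace ?T. lin_gauge z \<in> C}}
        = {s \<in> {0..<1}. h r + s / (1 - s) \<in> C}"
      using lin_gauge_ray_pt by (auto simp: topspace_cellular_space)
    ultimately show "closedin ?T {z \<in> topspace ?T. lin_gauge z \<in> C}"
      unfolding closedin_cellular_space by auto
  qed auto
  show "\<forall>(u, v)\<in>tree_arcs V edges r. strict_antimono_on {0..1} (\<lambda>s. lin_gauge (tree_pt V edges r (edge_point V u v s)))"
  proof (clarify)
    fix u v assume uv: "(u, v) \<in> tree_arcs V edges r"
    note e = tree_arcs_edge[OF uv]
    have lt: "h v < h u" using uv par_less by (simp add: arcs_iff)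
    have "lin_gauge (tree_pt V edges r (edge_point V u v s)) = (1 - s) * h u + s * h v" if "s \<in> {0..1}" for s
    proof -
      have "(\<Sum>w\<in>V. edge_point V u v s w * h w)
        = (\<Sum>w\<in>V. (1 - s) * (if w = u then h w else 0) + s * (if w = v then h w else 0))"
        using e(5) by (intro sum.cong) (auto simp: edge_point_apply)
      also have "\<dots> = (1 - s) * h u + s * h v"
        using fin e by (simp add: sum.distrib flip: sum_distrib_left)
      finally show ?thesis
        using lin_gauge_tree_pt[OF edge_point_in_realization[OF fin e(1,2,3,5)]] that by simp
    qed
    moreover have "(1 - t) * h u + t * h v < (1 - s) * h u + s * h v" if "s < t" for s t
    proof -
      have "0 < (t - s) * (h u - h v)" using that lt by simp
      then show ?thesis by (simp add: algebra_simps)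
    qed
    ultimately show "strict_antimono_on {0..1} (\<lambda>s. lin_gauge (tree_pt V edges r (edge_point V u v s)))"
      by (auto simp: monotone_on_def)
  qed
  show "strict_mono_on {0..<1} (\<lambda>s. lin_gauge (ray_pt V edges r s))"
  proof (rule strict_mono_onI)
    fix s t :: real assume st: "s \<in> {0..<1}" "t \<in> {0..<1}" "s < t"
    then have "s / (1 - s) < t / (1 - t)" by (simp add: field_simps)
    then show "lin_gauge (ray_pt V edges r s) < lin_gauge (ray_pt V edges r t)"
      using st by (simp add: lin_gauge_ray_pt)
  qed
  have lim: "filterlim (\<lambda>s::real. h r + s / (1 - s)) at_top (at_left 1)" by real_asymp
  have "eventually (\<lambda>s. s \<in> {0<..<1}) (at_left (1::real))"
    by (rule eventually_at_leftI[of 0]) auto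
  then have ev: "eventually (\<lambda>s. h r + s / (1 - s) = lin_gauge (ray_pt V edges r s)) (at_left 1)"
    by eventually_elim (simp add: lin_gauge_ray_pt)
  show "filterlim (\<lambda>s. lin_gauge (ray_pt V edges r s)) at_top (at_left 1)"
    using lim unfolding filterlim_cong[OF refl refl ev] .
qed

end

section \<open>The tree of a branch system\<close>

text \<open>A branch system in which no branch starts on another one and any two branches meet is cut
  into a tree at a finite set \<open>H\<close> of heights containing all those at which branches start or
  meet.  The vertices are the points at the heights in \<open>H\<close>, numbered by \<open>g\<close>, and the parent of
  a vertex is the point above it at the next height.  A vertex at which nothing starts or meets
  then has degree two, which is harmless.\<close>

locale branch_tree =
  fixes Z :: "'z topology" and p :: "'z \<Rightarrow> real" and I :: "'i set" and c :: "'i \<Rightarrow> real"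
    and \<gamma> :: "'i \<Rightarrow> real \<Rightarrow> 'z" and \<tau> :: "'i \<Rightarrow> 'i \<Rightarrow> real" and H :: "real set"
    and N :: nat and g :: "nat \<Rightarrow> 'z"
  assumes bs: "branch_system Z p I c \<gamma>" and I: "I \<noteq> {}"
    and meet: "\<And>i j t. i \<in> I \<Longrightarrow> j \<in> I \<Longrightarrow> c i \<le> t \<Longrightarrow> c j \<le> t \<Longrightarrow> \<gamma> i t = \<gamma> j t \<longleftrightarrow> \<tau> i j \<le> t"
    and start: "\<And>i j. i \<in> I \<Longrightarrow> j \<in> I \<Longrightarrow> i \<noteq> j \<Longrightarrow> c i < \<tau> i j \<and> c j < \<tau> i j"
    and H: "finite H" "\<And>i. i \<in> I \<Longrightarrow> c i \<in> H" "\<And>i j. i \<in> I \<Longrightarrow> j \<in> I \<Longrightarrow> i \<noteq> j \<Longrightarrow> \<tau> i j \<in> H"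
    and g: "bij_betw g {..<N} {z \<in> topspace Z. p z \<in> H}"
begin

text \<open>The height of a vertex, and the next height in \<open>H\<close>.  The latter is meaningless at and
  above the largest height.\<close>

definition "hgt k = p (g k)"
definition "nxt t = Min {s \<in> H. t < s}"

lemma vertexE:
  assumes "k < N"
  obtains i where "i \<in> I" "c i \<le> hgt k" "g k = \<gamma> i (hgt k)" "hgt k \<in> H"
proof -
  have "g k \<in> topspace Z" "p (g k) \<in> H" using g assms by (auto simp: bij_betw_def)
  then show ?thesis using branch_systemE[OF bs] that unfolding hgt_def by metis
qed

lemma vertex_ex:
  assumes "i \<in> I" "c i \<le> t" "t \<in> H"
  shows "\<exists>k<N. g k = \<gamma> i t \<and> hgt k = t"
proof -
  have "\<gamma> i t \<in> {z \<in> topspace Z. p z \<in> H}" using assms branch_systemD(5,8)[OF bs] by simp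
  moreover have "g ` {..<N} = {z \<in> topspace Z. p z \<in> H}" using g by (simp add: bij_betw_def)
  ultimately obtain k where "k < N" "\<gamma> i t = g k" by (metis (no_types, lifting) imageE lessThan_iff)
  then show ?thesis using branch_systemD(5)[OF bs assms(1,2)] by (intro exI[of _ k]) (simp add: hgt_def)
qed

lemma vertex_eqI: "k < N \<Longrightarrow> k' < N \<Longrightarrow> g k = g k' \<Longrightarrow> k = k'"
  using g by (auto simp: bij_betw_def inj_on_def)

text \<open>\<open>above k t k'\<close>: some branch climbs from the vertex \<open>k\<close> to the vertex \<open>k'\<close> at height
  \<open>t\<close>.  By \<open>above_branch\<close> every branch through \<open>k\<close> does so.\<close>

definition above :: "nat \<Rightarrow> real \<Rightarrow> nat \<Rightarrow> bool" where
  "above k t k' \<longleftrightarrow> k' < N \<and> hgt k' = t \<and> hgt k \<le> t \<and> (\<exists>i\<in>I. c i \<le> hgt k \<and> g k = \<gamma> i (hgt k) \<and> g k' = \<gamma> i t)"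

lemma above_branch:
  assumes "above k t k'" "i \<in> I" "c i \<le> hgt k" "g k = \<gamma> i (hgt k)"
  shows "g k' = \<gamma> i t"
  using assms branch_systemD(7)[OF bs, of _ i "hgt k" t] unfolding above_def by metis

lemma above_unique: "above k t k' \<Longrightarrow> above k t k'' \<Longrightarrow> k' = k''"
  using above_branch unfolding above_def by (metis vertex_eqI)

lemma above_ex:
  assumes "k < N" "t \<in> H" "hgt k \<le> t"
  shows "\<exists>k'. above k t k'"
proof -
  obtain i where i: "i \<in> I" "c i \<le> hgt k" "g k = \<gamma> i (hgt k)" using vertexE assms(1) by metis
  then have "c i \<le> t" using assms by simp
  then show ?thesis using vertex_ex[of i t] i assms unfolding above_def by blast
qed

lemma above_refl: "k < N \<Longrightarrow> above k (hgt k) k"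
  unfolding above_def using vertexE by (metis order_refl)

lemma above_trans:
  assumes "above k t k'" "above k' s k''"
  shows "above k s k''"
proof -
  obtain i where i: "i \<in> I" "c i \<le> hgt k" "g k = \<gamma> i (hgt k)" "g k' = \<gamma> i t" "hgt k \<le> t" "hgt k' = t"
    using assms(1) by (auto simp: above_def)
  then have "g k'' = \<gamma> i s" using above_branch[OF assms(2) i(1)] by simp
  then show ?thesis using i assms by (auto simp: above_def)
qed

lemma above_between:
  assumes "above k t k'" "above k s k''" "t \<le> s" "k < N"
  shows "above k' s k''"
proof -
  obtain i where i: "i \<in> I" "c i \<le> hgt k" "g k = \<gamma> i (hgt k)" using vertexE assms(4) by metis
  have "g k' = \<gamma> i t" "g k'' = \<gamma> i s" using above_branch i assms(1,2) by auto
  moreover have "hgt k' = t" "hgt k'' = s" "k'' < N" "hgt k \<le> t" using assms(1,2) by (auto simp: above_def)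
  ultimately show ?thesis using i assms(3) unfolding above_def by (auto intro!: bexI[of _ i])
qed

text \<open>The parent of a vertex other than the top one, and the top vertex, which is unique because
  all branches have met at the largest height.\<close>

definition "par k = (SOME k'. above k (nxt (hgt k)) k')"

definition "top_vertex = (SOME k. k < N \<and> hgt k = Max H)"

lemma H_ne: "H \<noteq> {}" using H(2) I by blast

lemma top_vertex: "top_vertex < N" "hgt top_vertex = Max H"
proof -
  obtain i where i: "i \<in> I" using I by blast
  have "c i \<le> Max H" using H(1,2) i by simp
  then have "\<exists>k. k < N \<and> hgt k = Max H" using vertex_ex[OF i _ Max_in[OF H(1) H_ne]] by blast
  from someI_ex[OF this] show "top_vertex < N" "hgt top_vertex = Max H" by (auto simp: top_vertex_def)
qed

lemma top_unique:
  assumes "k < N" "hgt k = Max H"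
  shows "k = top_vertex"
proof -
  obtain i where i: "i \<in> I" "c i \<le> hgt k" "g k = \<gamma> i (hgt k)" using vertexE assms(1) by metis
  obtain j where j: "j \<in> I" "c j \<le> hgt top_vertex" "g top_vertex = \<gamma> j (hgt top_vertex)" using vertexE top_vertex(1) by metis
  have "\<gamma> i (Max H) = \<gamma> j (Max H)"
    using meet[OF i(1) j(1), of "Max H"] H(1,3) i j assms top_vertex by (cases "i = j") auto
  then show ?thesis using i j assms top_vertex vertex_eqI by metis
qed

lemma nxt:
  assumes "k < N" "k \<noteq> top_vertex"
  shows "nxt (hgt k) \<in> H" "hgt k < nxt (hgt k)" "\<And>s. s \<in> H \<Longrightarrow> hgt k < s \<Longrightarrow> nxt (hgt k) \<le> s"
proof -
  have "hgt k \<in> H" using vertexE assms(1) by metis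
  then have "hgt k \<le> Max H" using H(1) by simp
  moreover have "hgt k \<noteq> Max H" using top_unique[OF assms(1)] assms(2) by blast
  ultimately have "hgt k < Max H" by simp
  then have "{s \<in> H. hgt k < s} \<noteq> {}" using Max_in[OF H(1) H_ne] by blast
  then have "Min {s \<in> H. hgt k < s} \<in> {s \<in> H. hgt k < s}" using H(1) by (intro Min_in) auto
  then show "nxt (hgt k) \<in> H" "hgt k < nxt (hgt k)" by (auto simp: nxt_def)
  show "nxt (hgt k) \<le> s" if "s \<in> H" "hgt k < s" for s
    using that H(1) by (simp add: nxt_def)
qed

lemma par_above:
  assumes "k < N" "k \<noteq> top_vertex"
  shows "above k (nxt (hgt k)) (par k)"
  unfolding par_def using above_ex[OF assms(1) nxt(1)[OF assms]] nxt(2)[OF assms] by (metis less_imp_le someI_ex)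

sublocale parent_tree "{..<N}" top_vertex par hgt
proof
  show "top_vertex \<in> {..<N}" using top_vertex by simp
  fix v assume "v \<in> {..<N}" "v \<noteq> top_vertex"
  then show "par v \<in> {..<N}" "hgt v < hgt (par v)"
    using par_above[of v] nxt(2)[of v] by (auto simp: above_def)
qed simp

abbreviation "A \<equiv> tree_arcs {..<N} edges top_vertex"

lemma ancestor_iff_above:
  assumes "k < N"
  shows "(k', k) \<in> A\<^sup>* \<longleftrightarrow> above k (hgt k') k'"
proof
  assume "(k', k) \<in> A\<^sup>*"
  then show "above k (hgt k') k'"
  proof (induction rule: converse_rtrancl_induct)
    case base
    then show ?case using above_refl assms by blast
  next
    case (step k'' k')
    then have "above k' (nxt (hgt k')) k''" using par_above by (simp add: arcs_iff)
    then have "above k (nxt (hgt k')) k''" using step above_trans by blast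
    then show ?case by (simp add: above_def)
  qed
next
  assume "above k (hgt k') k'"
  then show "(k', k) \<in> A\<^sup>*"
    using assms
  proof (induction "card {s \<in> H. hgt k < s}" arbitrary: k rule: less_induct)
    case less
    show ?case
    proof (cases "hgt k' = hgt k")
      case True
      then have "k' = k" using above_unique above_refl less.prems by metis
      then show ?thesis by simp
    next
      case False
      then have lt: "hgt k < hgt k'" and k': "k' < N" using less.prems by (auto simp: above_def)
      have "hgt k' \<in> H" using vertexE[OF k'] by metis
      moreover from this have "hgt k' \<le> Max H" using H(1) by simp
      ultimately have kr: "k \<noteq> top_vertex" using lt top_vertex by auto
      have n: "nxt (hgt k) \<le> hgt k'" using nxt(3)[OF less.prems(2) kr] \<open>hgt k' \<in> H\<close> lt by blast
      have pa: "above k (nxt (hgt k)) (par k)" using par_above[OF less.prems(2) kr] .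
      have 1: "above (par k) (hgt k') k'" using above_between[OF pa less.prems(1) n less.prems(2)] .
      have hp: "hgt (par k) = nxt (hgt k)" "par k < N" using pa by (auto simp: above_def)
      have "{s \<in> H. hgt (par k) < s} \<subset> {s \<in> H. hgt k < s}"
        using hp nxt(1,2)[OF less.prems(2) kr] by auto
      then have "card {s \<in> H. hgt (par k) < s} < card {s \<in> H. hgt k < s}"
        using H(1) by (intro psubset_card_mono) auto
      from less.hyps[OF this 1 hp(2)] have "(k', par k) \<in> A\<^sup>*" .
      moreover have "(par k, k) \<in> A" using less.prems(2) kr by (simp add: arcs_iff)
      ultimately show ?thesis by (rule rtrancl_into_rtrancl)
    qed
  qed
qed

text \<open>The vertex at which branch \<open>i\<close> starts.\<close>

definition "lf i = (SOME k. k < N \<and> g k = \<gamma> i (c i) \<and> hgt k = c i)"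

lemma lf:
  assumes "i \<in> I"
  shows "lf i < N" "g (lf i) = \<gamma> i (c i)" "hgt (lf i) = c i"
  using someI_ex[of "\<lambda>k. k < N \<and> g k = \<gamma> i (c i) \<and> hgt k = c i"] vertex_ex[OF assms order_refl H(2)[OF assms]]
  unfolding lf_def by blast+

lemma above_lf_iff:
  assumes "i \<in> I"
  shows "above (lf i) t k \<longleftrightarrow> k < N \<and> hgt k = t \<and> c i \<le> t \<and> g k = \<gamma> i t"
  using above_branch[of "lf i" t k i] lf[OF assms] assms unfolding above_def by auto

lemma leaves: "bij_betw lf I (tree_leaves {..<N} edges top_vertex)"
  unfolding bij_betw_def
proof (intro conjI inj_onI subset_antisym)
  fix i j assume ij: "i \<in> I" "j \<in> I" "lf i = lf j"
  then have "c i = c j" "\<gamma> i (c i) = \<gamma> j (c i)" using lf by metis+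
  then show "i = j" using meet[OF ij(1,2), of "c i"] start[OF ij(1,2)] by fastforce
next
  show "lf ` I \<subseteq> tree_leaves {..<N} edges top_vertex"
  proof
    fix k assume "k \<in> lf ` I"
    then obtain i where i: "i \<in> I" "k = lf i" by blast
    have "(k, k') \<notin> A" for k'
    proof
      assume a: "(k, k') \<in> A"
      then have k': "k' < N" "k' \<noteq> top_vertex" "k = par k'" by (auto simp: arcs_iff)
      have "above k' (nxt (hgt k')) k" using par_above[OF k'(1,2)] k'(3) by simp
      then have ab: "above k' (c i) k" "hgt k' < c i"
        using nxt(2)[OF k'(1,2)] lf[OF i(1)] i(2) by (auto simp: above_def)
      obtain j where j: "j \<in> I" "c j \<le> hgt k'" "g k' = \<gamma> j (hgt k')" using vertexE k'(1) by metis
      have "\<gamma> i (c i) = \<gamma> j (c i)" using above_branch[OF ab(1) j] lf[OF i(1)] i(2) by simp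
      moreover have "i \<noteq> j" using ab(2) j(2) by auto
      ultimately show False using meet[OF i(1) j(1), of "c i"] start[OF i(1) j(1)] ab(2) j(2) by auto
    qed
    then show "k \<in> tree_leaves {..<N} edges top_vertex"
      using lf(1)[OF i(1)] i(2) by (simp add: tree_leaves_eq[OF rooted])
  qed
next
  show "tree_leaves {..<N} edges top_vertex \<subseteq> lf ` I"
  proof
    fix k assume "k \<in> tree_leaves {..<N} edges top_vertex"
    then have k: "k < N" "\<And>k'. (k, k') \<notin> A" by (auto simp: tree_leaves_eq[OF rooted])
    obtain i where i: "i \<in> I" "c i \<le> hgt k" "g k = \<gamma> i (hgt k)" using vertexE k(1) by metis
    have "above (lf i) (hgt k) k" using above_lf_iff[OF i(1)] k i by blast
    then have "(k, lf i) \<in> A\<^sup>*" using ancestor_iff_above[OF lf(1)[OF i(1)]] by blast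
    then have "k = lf i" using k(2) by (auto elim: converse_rtranclE)
    then show "k \<in> lf ` I" using i(1) by blast
  qed
qed

lemma LCA_height:
  assumes ij: "i \<in> I" "j \<in> I" "i \<noteq> j"
  shows "LCA {..<N} edges top_vertex (lf i) (lf j) \<in> {..<N}"
    and "hgt (LCA {..<N} edges top_vertex (lf i) (lf j)) = \<tau> i j"
proof -
  let ?l = "LCA {..<N} edges top_vertex (lf i) (lf j)"
  have dec: "hgt v < hgt u" if "(u, v) \<in> A" for u v using that par_less by (auto simp: arcs_iff)
  have V: "lf i \<in> {..<N}" "lf j \<in> {..<N}" using lf ij by auto
  note lca = LCA_characterization[OF rooted, of hgt, OF dec V]
  have anc: "(b, lf i) \<in> A\<^sup>* \<and> (b, lf j) \<in> A\<^sup>* \<longleftrightarrow>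
      b < N \<and> \<tau> i j \<le> hgt b \<and> c i \<le> hgt b \<and> c j \<le> hgt b \<and> g b = \<gamma> i (hgt b)" for b
    using ancestor_iff_above[OF lf(1)] above_lf_iff meet[OF ij(1,2), of "hgt b"] ij by auto
  have "\<tau> i j \<le> hgt ?l" using lca(1)[of ?l] anc[of ?l] by blast
  moreover obtain b where b: "b < N" "g b = \<gamma> i (\<tau> i j)" "hgt b = \<tau> i j"
    using vertex_ex[of i "\<tau> i j"] start[OF ij] H(3)[OF ij] ij by auto
  then have "(b, ?l) \<in> A\<^sup>*" using lca(1)[of b] anc[of b] start[OF ij] by auto
  then have "hgt ?l \<le> \<tau> i j" using arcs_rtrancl_mono[of A hgt, OF dec] b(3) by fastforce
  ultimately show "hgt ?l = \<tau> i j" by simp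
  show "?l \<in> {..<N}" by (rule lca(2))
qed

end

section \<open>The characterization\<close>

lemma finite_leaves: "rooted_tree V E r \<Longrightarrow> finite (tree_leaves V E r)"
  using rooted_tree_facts(1) tree_leaves_eq by (metis (no_types, lifting) finite_subset mem_Collect_eq subsetI)

text \<open>If the spaces are isomorphic, the branches of the cellular merge tree transport to the merge
  tree and reveal the local minima of \<open>f\<close>.  If the local minima have the prescribed values and
  merge levels, both spaces have branch systems with the same coincidences.\<close>

lemma labelled_merge_tree_iff:
  assumes X: "compact_space X" "Hausdorff_space X" "continuous_map X euclideanreal f"
    and conn: "connected_space X"
    and T: "cellular_merge_tree V E r p" and l: "bij_betw l {1..n::nat} (tree_leaves V E r)"
  shows "gauged_isomorphic (merge_tree X f) merge_tree_gauge (cellular_space V E r) p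
         \<longleftrightarrow>
         (\<exists>M. bij_betw M {1..n} (local_minima X f) \<and>
              (\<forall>i\<in>{1..n}. common_value f (M i) = p (vertex_pt V E r (l i))) \<and>
              (\<forall>i j. 1 \<le> i \<and> i < j \<and> j \<le> n \<longrightarrow>
                 merge_level X f (M i) (M j) = p (vertex_pt V E r (LCA V E r (l i) (l j)))))"
    (is "?iso \<longleftrightarrow> ?cond")
proof -
  interpret cellular V E r p by (rule cellular.intro) (rule T)
  let ?I = "{1..n}"
  let ?c = "\<lambda>i. p (vp (l i))" and ?\<tau> = "\<lambda>i j. p (vp (LCA V E r (l i) (l j)))"
  have img: "l ` ?I = tree_leaves V E r" and inj: "inj_on l ?I" using l by (auto simp: bij_betw_def)
  have leaf: "l i \<in> tree_leaves V E r" if "i \<in> ?I" for i using img that by blast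
  have lV: "l i \<in> V" if "i \<in> ?I" for i using leaf[OF that] leaf_V by blast
  obtain \<delta> where bs: "branch_system T p ?I ?c \<delta>"
    and meet: "\<And>i j t. i \<in> ?I \<Longrightarrow> j \<in> ?I \<Longrightarrow> ?c i \<le> t \<Longrightarrow> ?c j \<le> t \<Longrightarrow> \<delta> i t = \<delta> j t \<longleftrightarrow> ?\<tau> i j \<le> t"
    using leaf_branch_system[OF _ img] by auto
  have start: "?c i < ?\<tau> i j" "?c j < ?\<tau> i j" if "i \<in> ?I" "j \<in> ?I" "i \<noteq> j" for i j
  proof -
    have "l i \<noteq> l j" using inj_on_eq_iff[OF inj that(1,2)] that(3) by simp
    then show "?c i < ?\<tau> i j" "?c j < ?\<tau> i j"
      using leaf_below_LCA[of "l i" "l j"] leaf_below_LCA[of "l j" "l i"]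
        LCA_sym[of "l i" "l j"] leaf lV that by auto
  qed
  show ?thesis
  proof
    assume ?iso
    from branch_system_transport[OF bs this] obtain \<gamma> where
      bs': "branch_system (merge_tree X f) merge_tree_gauge ?I ?c \<gamma>"
      and \<gamma>: "\<forall>i\<in>?I. \<forall>j\<in>?I. \<forall>s t. ?c i \<le> s \<and> ?c j \<le> t \<longrightarrow> (\<gamma> i s = \<gamma> j t) = (\<delta> i s = \<delta> j t)"
      by blast
    have \<gamma>meet: "\<gamma> i t = \<gamma> j t \<longleftrightarrow> ?\<tau> i j \<le> t" if "i \<in> ?I" "j \<in> ?I" "?c i \<le> t" "?c j \<le> t" for i j t
      using \<gamma> meet[OF that] that by blast
    have irr: "i = j" if "i \<in> ?I" "j \<in> ?I" "?c j \<le> ?c i" "\<gamma> i (?c i) = \<gamma> j (?c i)" for i j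
      using \<gamma>meet[OF that(1,2) order_refl that(3)] start[OF that(1,2)] that(4) by fastforce
    obtain M where M: "bij_betw M ?I (local_minima X f)" "\<forall>i\<in>?I. common_value f (M i) = ?c i"
      and lev: "\<forall>i\<in>?I. \<forall>j\<in>?I. \<forall>t. merge_level X f (M i) (M j) \<le> t \<longleftrightarrow> ?c i \<le> t \<and> ?c j \<le> t \<and> \<gamma> i t = \<gamma> j t"
      using local_minima_of_branch_system[OF X conn bs' irr] by blast
    have "merge_level X f (M i) (M j) = ?\<tau> i j" if "1 \<le> i \<and> i < j \<and> j \<le> n" for i j
    proof -
      have ij: "i \<in> ?I" "j \<in> ?I" "i \<noteq> j" using that by auto
      have "merge_level X f (M i) (M j) \<le> t \<longleftrightarrow> ?\<tau> i j \<le> t" for t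
        using lev ij \<gamma>meet[OF ij(1,2), of t] start[OF ij] by fastforce
      then show ?thesis by (metis order_antisym order_refl)
    qed
    then show ?cond using M by blast
  next
    assume ?cond
    then obtain M where M: "bij_betw M ?I (local_minima X f)" "\<forall>i\<in>?I. common_value f (M i) = ?c i"
      and lev: "\<And>i j. 1 \<le> i \<and> i < j \<and> j \<le> n \<Longrightarrow> merge_level X f (M i) (M j) = ?\<tau> i j" by blast
    have MI: "M i \<in> local_minima X f" if "i \<in> ?I" for i using M(1) that by (auto simp: bij_betw_def)
    then have "\<forall>i\<in>?I. \<exists>x. x \<in> M i" using local_minimum_nonempty by blast
    from bchoice[OF this] obtain x where x: "\<And>i. i \<in> ?I \<Longrightarrow> x i \<in> M i" by blast
    let ?\<gamma> = "\<lambda>i t. merge_rel X f `` {(x i, t)}"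
    have "M ` ?I = local_minima X f" using M(1) by (simp add: bij_betw_def)
    from merge_tree_branch_system[OF X _ this x, of ?c]
    have bs': "branch_system (merge_tree X f) merge_tree_gauge ?I ?c ?\<gamma>"
      using M(2) by blast
    have xi: "x i \<in> topspace X" "f (x i) = ?c i" if "i \<in> ?I" for i
    proof -
      have "common_value f (M i) = ?c i" using M(2) that by blast
      then show "x i \<in> topspace X" "f (x i) = ?c i"
        using local_minimum_at(1,2)[OF MI[OF that] x[OF that]] by simp_all
    qed
    have joined: "?\<gamma> i t = ?\<gamma> j t \<longleftrightarrow> merge_level X f (M i) (M j) \<le> t"
      if "i \<in> ?I" "j \<in> ?I" "?c i \<le> t" "?c j \<le> t" for i j t
    proof -
      have "(x i, t) \<in> epigraph_of X f" "(x j, t) \<in> epigraph_of X f"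
        using xi that by (auto simp: epigraph_of_def)
      then show ?thesis
        using merge_class_eq joined_iff_merge_level[OF X conn MI[OF that(1)] MI[OF that(2)] x[OF that(1)] x[OF that(2)]]
        by metis
    qed
    have meet': "?\<gamma> i t = ?\<gamma> j t \<longleftrightarrow> \<delta> i t = \<delta> j t"
      if ij: "i \<in> ?I" "j \<in> ?I" "?c i \<le> t" "?c j \<le> t" for i j t
    proof (cases i j rule: linorder_cases)
      case less
      then show ?thesis using joined[OF ij] meet[OF ij] lev[of i j] ij by simp
    next
      case greater
      then show ?thesis using joined[OF ij(2,1,4,3)] meet[OF ij(2,1,4,3)] lev[of j i] ij by auto
    qed simp
    show ?iso using branch_system_isomorphic[OF bs' bs meet'] .
  qed
qed

text \<open>A continuous function with finitely many local minima has a cellular merge tree.\<close>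

lemma cellular_merge_tree_exists:
  assumes X: "compact_space X" "Hausdorff_space X" "continuous_map X euclideanreal f"
    and conn: "connected_space X" and ne: "topspace X \<noteq> {}" and fin: "finite (local_minima X f)"
  shows "\<exists>(V :: nat set) E r p. cellular_merge_tree V E r p \<and>
         gauged_isomorphic (merge_tree X f) merge_tree_gauge (cellular_space V E r) p"
proof -
  obtain n and M :: "nat \<Rightarrow> 'a set" where M: "bij_betw M {1..n} (local_minima X f)"
    using ex_bij_betw_nat_finite_1[OF fin] by blast
  let ?I = "{1..n}"
  let ?c = "\<lambda>i. common_value f (M i)" and ?\<tau> = "\<lambda>i j. merge_level X f (M i) (M j)"
  have MI: "M i \<in> local_minima X f" if "i \<in> ?I" for i using M that by (auto simp: bij_betw_def)
  then have "\<forall>i\<in>?I. \<exists>x. x \<in> M i" using local_minimum_nonempty by blast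
  from bchoice[OF this] obtain x where x: "\<And>i. i \<in> ?I \<Longrightarrow> x i \<in> M i" by blast
  let ?\<gamma> = "\<lambda>i t. merge_rel X f `` {(x i, t)}"
  have bs: "branch_system (merge_tree X f) merge_tree_gauge ?I ?c ?\<gamma>"
  proof (rule merge_tree_branch_system[OF X _ _ x])
    show "M ` ?I = local_minima X f" using M by (simp add: bij_betw_def)
  qed auto
  have xi: "x i \<in> topspace X" "?c i = f (x i)" "M i = Collect (joined X f (f (x i)) (x i))" if "i \<in> ?I" for i
    using local_minimum_at[OF MI[OF that] x[OF that]] by auto
  have lev: "joined X f t (x i) (x j) \<longleftrightarrow> ?\<tau> i j \<le> t" if "i \<in> ?I" "j \<in> ?I" for i j t
    using joined_iff_merge_level[OF X conn MI[OF that(1)] MI[OF that(2)] x[OF that(1)] x[OF that(2)]] .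
  have meet: "?\<gamma> i t = ?\<gamma> j t \<longleftrightarrow> ?\<tau> i j \<le> t"
    if ij: "i \<in> ?I" "j \<in> ?I" "?c i \<le> t" "?c j \<le> t" for i j t
  proof -
    have "(x i, t) \<in> epigraph_of X f" "(x j, t) \<in> epigraph_of X f"
      using xi ij by (auto simp: epigraph_of_def)
    then show ?thesis using merge_class_eq lev[OF ij(1,2)] by metis
  qed
  have less: "?c i < ?\<tau> i j" if ij: "i \<in> ?I" "j \<in> ?I" "i \<noteq> j" for i j
  proof -
    have j: "joined X f (?\<tau> i j) (x i) (x j)" using lev[OF ij(1,2)] by simp
    have "?\<tau> i j \<noteq> ?c i"
    proof
      assume "?\<tau> i j = ?c i"
      then have "x j \<in> M i" using j xi[OF ij(1)] by auto
      then have "M i = Collect (joined X f (f (x j)) (x j))"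
        by (rule local_minimum_at(3)[OF MI[OF ij(1)]])
      then have "M i = M j" by (simp only: xi(3)[OF ij(2), symmetric])
      then show False using inj_on_eq_iff[of M ?I i j] M ij by (simp add: bij_betw_def)
    qed
    then show ?thesis using joinedD(3)[OF j] xi[OF ij(1)] by simp
  qed
  have "?\<tau> i j = ?\<tau> j i" if "i \<in> ?I" "j \<in> ?I" for i j
    using lev[OF that] lev[OF that(2,1)] connected_component_of_sym by (metis order_antisym order_refl)
  then have start: "?c i < ?\<tau> i j \<and> ?c j < ?\<tau> i j" if "i \<in> ?I" "j \<in> ?I" "i \<noteq> j" for i j
    using less that by metis
  have I: "?I \<noteq> {}"
  proof -
    obtain y where "y \<in> topspace X" using ne by blast
    then have "local_minima X f \<noteq> {}" using local_minimum_below[OF X(1,3)] by blast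
    then show ?thesis using M by (auto simp: bij_betw_def)
  qed
  \<comment> \<open>Cut the merge tree at all the heights where branches start or meet.\<close>
  define H where "H = ?c ` ?I \<union> (\<lambda>(i, j). ?\<tau> i j) ` (?I \<times> ?I)"
  have H: "finite H" "\<And>i. i \<in> ?I \<Longrightarrow> ?c i \<in> H" "\<And>i j. i \<in> ?I \<Longrightarrow> j \<in> ?I \<Longrightarrow> ?\<tau> i j \<in> H"
    unfolding H_def by auto
  let ?V = "{z \<in> topspace (merge_tree X f). merge_tree_gauge z \<in> H}"
  have "?V \<subseteq> (\<lambda>(i, t). ?\<gamma> i t) ` (?I \<times> H)"
  proof
    fix z assume z: "z \<in> ?V"
    then obtain i where "i \<in> ?I" "z = ?\<gamma> i (merge_tree_gauge z)"
      using branch_systemE[OF bs] by (metis (no_types, lifting) mem_Collect_eq)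
    then show "z \<in> (\<lambda>(i, t). ?\<gamma> i t) ` (?I \<times> H)"
      using z by (intro image_eqI[of _ _ "(i, merge_tree_gauge z)"]) auto
  qed
  then have "finite ?V" using H(1) finite_subset by blast
  then obtain N g where g: "bij_betw g {..<N::nat} ?V"
    using ex_bij_betw_nat_finite by (metis atLeast0LessThan)
  interpret branch_tree "merge_tree X f" merge_tree_gauge ?I ?c ?\<gamma> ?\<tau> H N g
    using bs I meet start H g by (rule branch_tree.intro)
  have hv: "lin_gauge (vertex_pt {..<N} edges top_vertex k) = hgt k" if "k < N" for k
    using lin_gauge_vertex_pt that by simp
  have lfc: "lin_gauge (vertex_pt {..<N} edges top_vertex (lf i)) = ?c i" if "i \<in> ?I" for i
    using lf[OF that] hv by simp
  have lca: "lin_gauge (vertex_pt {..<N} edges top_vertex (LCA {..<N} edges top_vertex (lf i) (lf j))) = ?\<tau> i j"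
    if "i \<in> ?I" "j \<in> ?I" "i \<noteq> j" for i j
    using LCA_height[OF that] hv by simp
  have "gauged_isomorphic (merge_tree X f) merge_tree_gauge (cellular_space {..<N} edges top_vertex) lin_gauge"
    unfolding labelled_merge_tree_iff[OF X conn cellular leaves]
    using M lfc lca by (intro exI[of _ M]) auto
  then show ?thesis using cellular by blast
qed

theorem theorem8:
  fixes X :: "'a topology" and f :: "'a \<Rightarrow> real"
  assumes "compact_space X" and "Hausdorff_space X"
    and "connected_space X" and "topspace X \<noteq> {}"
    and "continuous_map X euclideanreal f"
  shows
    "((\<exists>(V :: nat set) E r p. cellular_merge_tree V E r p \<and>
         gauged_isomorphic (merge_tree X f) merge_tree_gauge (cellular_space V E r) p)
       \<longleftrightarrow> finite (local_minima X f)) \<and>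
     (\<forall>(V :: 'v set) E r p n l m d. labelled_cellular_merge_tree V E r p n l m d \<longrightarrow>
        (gauged_isomorphic (merge_tree X f) merge_tree_gauge (cellular_space V E r) p
         \<longleftrightarrow>
         (\<exists>M. bij_betw M {1..n} (local_minima X f) \<and>
              (\<forall>i\<in>{1..n}. common_value f (M i) = p (vertex_pt V E r (l i))) \<and>
              (\<forall>i j. 1 \<le> i \<and> i < j \<and> j \<le> n \<longrightarrow>
                 merge_level X f (M i) (M j) = p (vertex_pt V E r (LCA V E r (l i) (l j)))))))"
proof (intro conjI)
  let ?cellular = "\<exists>(V :: nat set) E r p. cellular_merge_tree V E r p \<and>
         gauged_isomorphic (merge_tree X f) merge_tree_gauge (cellular_space V E r) p"
  show "?cellular \<longleftrightarrow> finite (local_minima X f)"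
  proof
    assume ?cellular
    then obtain V :: "nat set" and E r p where T: "cellular_merge_tree V E r p"
      and iso: "gauged_isomorphic (merge_tree X f) merge_tree_gauge (cellular_space V E r) p" by blast
    have "finite (tree_leaves V E r)" using finite_leaves[of V E r] T by (simp add: cellular_merge_tree_def)
    then obtain n l where l: "bij_betw l {1..n::nat} (tree_leaves V E r)"
      using ex_bij_betw_nat_finite_1 by blast
    obtain M where "bij_betw M {1..n} (local_minima X f)"
      using labelled_merge_tree_iff[OF assms(1,2,5,3) T l] iso by blast
    then show "finite (local_minima X f)" using bij_betw_finite by blast
  next
    assume "finite (local_minima X f)"
    then show ?cellular by (rule cellular_merge_tree_exists[OF assms(1,2,5,3,4)])
  qed
next
  show "\<forall>(V :: 'v set) E r p n l m d. labelled_cellular_merge_tree V E r p n l m d \<longrightarrow>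
        (gauged_isomorphic (merge_tree X f) merge_tree_gauge (cellular_space V E r) p
         \<longleftrightarrow>
         (\<exists>M. bij_betw M {1..n} (local_minima X f) \<and>
              (\<forall>i\<in>{1..n}. common_value f (M i) = p (vertex_pt V E r (l i))) \<and>
              (\<forall>i j. 1 \<le> i \<and> i < j \<and> j \<le> n \<longrightarrow>
                 merge_level X f (M i) (M j) = p (vertex_pt V E r (LCA V E r (l i) (l j))))))"
    unfolding labelled_cellular_merge_tree_def
    by (intro allI impI, elim conjE) (rule labelled_merge_tree_iff[OF assms(1,2,5,3)])
qed

end
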